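(* For any balanced spatial graph $(G,\omega)$, let $(G^*,\omega)$ be the inverse of $G$ (i.e. the orientation of every edge is reversed, with the same weights), and let $(\overline{G},\omega)$ be the mirror image of $G$ (using the same orientations and weights as in $G$). Then for every $k\ge 0$, $\Delta_k(G^*,\omega)(t)=\Delta_k(\overline{G},\omega)(t)=\Delta_k(G,\omega)(t^{-1})$, up to multiplication by units $\pm t^r$ of $\mathbb{Z}[t^{\pm1}]$.
   Context: An oriented spatial graph $G$ is the image of an embedding in $\mathbb{R}^3\subset S^3$ of a finite abstract directed graph (every component contains at least one vertex). A diagram $D$ of $G$ is a regular projection to a plane with over/under information; if $D$ has $c$ crossings, $v$ vertices and $e$ edges, then cutting the edges at undercrossings gives $c+e$ arcs. A weighting $\omega$ assigns to each edge an integer; it is balanced if at each vertex the sum of the weights of the edges directed in equals the sum of the weights of the edges directed out. A balanced spatial graph is a pair $(G,\omega)$ with $\omega$ balanced. The weight of an arc is that of the edge containing it. The mirror image $\overline{G}$ is the image of $G$ under a reflection of $\mathbb{R}^3$ (e.g. reflect the diagram across a line in the plane). Alexander matrix $M(D,\omega)$: the $(c+v)\times(c+e)$ matrix over $\mathbb{Z}[t^{\pm1}]$ with one column per arc and one row per crossing and per vertex. At a crossing with overarc $b$ of weight $w_1$ and underarcs $a$ (on the right of $b$) and $c$ (on the left of $b$), both of weight $w_2$, the row is given by the relation $(1-t^{w_2})b+t^{w_1}c-a=0$. At a vertex whose incident arc-ends, in clockwise order from an arbitrary starting point, are $a_1,\dots,a_n$ with weights $w_1,\dots,w_n$ and local signs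 $\varepsilon_i$ ($+1$ if directed into the vertex, $-1$ if directed out), the row is given by $\sum_{i=1}^n\varepsilon_i t^{m_i}a_i=0$, where $m_i=\varepsilon_1w_1+\cdots+\varepsilon_{i-1}w_{i-1}+\min\{\varepsilon_i,0\}w_i$. (Coefficients of the same arc are added.) For a matrix $M$, $\det(M,k)$ is the greatest common divisor of all $k\times k$ minors of $M$ (equal to $0$ if there are no such minors), with $\det(M,k)=1$ if $k\le 0$. The $k$th Alexander polynomial is $\Delta_k(G,\omega)(t)=\det(M(D,\omega),\,c+v-k)\in\mathbb{Z}[t^{\pm1}]$, defined up to multiplication by units $\pm t^r$; up to such units it does not depend on the diagram $D$. *)

theory Defs
  imports
    "HOL-Analysis.Analysis"
    "HOL-Library.Poly_Mapping"
    "Graph_Theory.Digraph"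
    "Jordan_Normal_Form.Determinant"
    "Jordan_Normal_Form.DL_Submatrix"
begin

section \<open>Laurent polynomials and determinantal divisors\<close>

text \<open>\<open>\<int>[t, t\<^sup>-\<^sup>1]\<close> is the group ring of \<open>\<int>\<close>: \<open>Poly_Mapping.single r c\<close> is \<open>c t^r\<close>, and the
  multiplication of \<open>\<Rightarrow>\<^sub>0\<close> is convolution.  Its units are the \<open>\<plusminus> t^r\<close>.\<close>

type_synonym laurent = "int \<Rightarrow>\<^sub>0 int"

definition t_pow :: "int \<Rightarrow> laurent"
  where "t_pow r = Poly_Mapping.single r 1"

text \<open>The substitution \<open>t \<mapsto> t\<^sup>-\<^sup>1\<close>.\<close>

definition invert_t :: "laurent \<Rightarrow> laurent"
  where "invert_t p = Poly_Mapping.map_key uminus p"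

text \<open>\<open>\<int>[t, t\<^sup>-\<^sup>1]\<close> has no chosen normal form for associates, so a gcd is a relation.  It determines
  \<open>g\<close> exactly up to units, and the only gcd of the empty set is \<open>0\<close>.\<close>

definition is_gcd_of :: "'a::comm_ring_1 \<Rightarrow> 'a set \<Rightarrow> bool"
  where "is_gcd_of g S \<longleftrightarrow> (\<forall>m\<in>S. g dvd m) \<and> (\<forall>d. (\<forall>m\<in>S. d dvd m) \<longrightarrow> d dvd g)"

definition minors :: "'a::comm_ring_1 Matrix.mat \<Rightarrow> nat \<Rightarrow> 'a set"
  where "minors M k = {Determinant.det (submatrix M I J) | I J.
    I \<subseteq> {..<dim_row M} \<and> J \<subseteq> {..<dim_col M} \<and> card I = k \<and> card J = k}"

text \<open>\<open>g\<close> represents \<open>det(M, k)\<close>.\<close>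

definition is_minor_gcd :: "'a::comm_ring_1 Matrix.mat \<Rightarrow> int \<Rightarrow> 'a \<Rightarrow> bool"
  where "is_minor_gcd M k g \<longleftrightarrow> is_gcd_of g (if k \<le> 0 then {1} else minors M (nat k))"

section \<open>Spatial graphs\<close>

text \<open>An embedding of an abstract directed multigraph (loops allowed): \<open>point\<close> places the vertices, and
  \<open>curve e\<close> parametrises the edge \<open>e\<close> from its tail to its head.\<close>

record ('v, 'e) spatial =
  graph :: "('v, 'e) pre_digraph"
  point :: "'v \<Rightarrow> real^3"
  curve :: "'e \<Rightarrow> real \<Rightarrow> real^3"

definition spatial_graph :: "('v, 'e) spatial \<Rightarrow> bool"
  where "spatial_graph \<Gamma> \<longleftrightarrow>
    fin_digraph (graph \<Gamma>) \<and>
    inj_on (point \<Gamma>) (verts (graph \<Gamma>)) \<and>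
    (\<forall>e\<in>arcs (graph \<Gamma>). path (curve \<Gamma> e) \<and>
       pathstart (curve \<Gamma> e) = point \<Gamma> (tail (graph \<Gamma>) e) \<and>
       pathfinish (curve \<Gamma> e) = point \<Gamma> (head (graph \<Gamma>) e)) \<and>
    inj_on (\<lambda>(e, s). curve \<Gamma> e s) (arcs (graph \<Gamma>) \<times> {0<..<1}) \<and>
    (\<forall>e\<in>arcs (graph \<Gamma>). \<forall>s\<in>{0<..<1}. curve \<Gamma> e s \<notin> point \<Gamma> ` verts (graph \<Gamma>))"

definition support :: "('v, 'e) spatial \<Rightarrow> (real^3) set"
  where "support \<Gamma> = point \<Gamma> ` verts (graph \<Gamma>) \<union> (\<Union>e\<in>arcs (graph \<Gamma>). path_image (curve \<Gamma> e))"

definition balanced :: "('v, 'e) pre_digraph \<Rightarrow> ('e \<Rightarrow> int) \<Rightarrow> bool"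
  where "balanced G \<omega> \<longleftrightarrow>
    (\<forall>v\<in>verts G. (\<Sum>e\<in>in_arcs G v. \<omega> e) = (\<Sum>e\<in>out_arcs G v. \<omega> e))"

definition inverse_graph :: "('v, 'e) spatial \<Rightarrow> ('v, 'e) spatial"
  where "inverse_graph \<Gamma> =
    \<lparr>graph = (graph \<Gamma>)\<lparr>tail := head (graph \<Gamma>), head := tail (graph \<Gamma>)\<rparr>,
     point = point \<Gamma>,
     curve = (\<lambda>e. reversepath (curve \<Gamma> e))\<rparr>"

definition plane_reflection :: "(real^3 \<Rightarrow> real^3) \<Rightarrow> bool"
  where "plane_reflection \<rho> \<longleftrightarrow>
    (\<exists>a n. n \<noteq> 0 \<and> \<rho> = (\<lambda>x. x - (2 * ((x - a) \<bullet> n) / (n \<bullet> n)) *\<^sub>R n))"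

definition image_graph :: "(real^3 \<Rightarrow> real^3) \<Rightarrow> ('v, 'e) spatial \<Rightarrow> ('v, 'e) spatial"
  where "image_graph \<rho> \<Gamma> =
    \<lparr>graph = graph \<Gamma>, point = (\<lambda>v. \<rho> (point \<Gamma> v)), curve = (\<lambda>e s. \<rho> (curve \<Gamma> e s))\<rparr>"

text \<open>Equivalence of oriented spatial graphs by an ambient isotopy of \<open>\<real>\<^sup>3\<close>, that is, by a homeomorphism
  joined to the identity through homeomorphisms.  Only the oriented images of the edges matter:
  they may be reparametrised by an increasing \<open>\<phi>\<close>.\<close>

definition ambient_isotopic :: "('v, 'e) spatial \<Rightarrow> ('v, 'e) spatial \<Rightarrow> bool"
  where "ambient_isotopic \<Gamma> \<Delta> \<longleftrightarrow> graph \<Delta> = graph \<Gamma> \<and>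
    (\<exists>h. homotopic_with_canon (\<lambda>f. \<exists>g. homeomorphism UNIV UNIV f g) UNIV UNIV id h \<and>
      (\<forall>v\<in>verts (graph \<Gamma>). point \<Delta> v = h (point \<Gamma> v)) \<and>
      (\<forall>e\<in>arcs (graph \<Gamma>). \<exists>\<phi>. strict_mono_on {0..1} \<phi> \<and> continuous_on {0..1} \<phi> \<and>
         \<phi> ` {0..1} = {0..1} \<and> (\<forall>s\<in>{0..1}. curve \<Delta> e s = h (curve \<Gamma> e (\<phi> s)))))"

section \<open>Diagrams\<close>

text \<open>Diagrams are drawn in the \<open>xy\<close>-plane, viewed from above (larger \<open>z\<close> is over); the plane is
  identified with \<open>\<complex>\<close>.  Rotations are ambient isotopies, so fixing the plane loses nothing when
  the graph itself is taken up to ambient isotopy.  A diagram is a spatial graph in regular position;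
  points of its edges are addressed as \<open>(e, s)\<close> with \<open>s\<close> the parameter.\<close>

definition plane :: "real^3 \<Rightarrow> complex"
  where "plane x = Complex (vec_nth x 1) (vec_nth x 2)"

definition height :: "real^3 \<Rightarrow> real"
  where "height x = vec_nth x 3"

definition shadow :: "('v, 'e) spatial \<Rightarrow> 'e \<Rightarrow> real \<Rightarrow> complex"
  where "shadow \<Delta> e s = plane (curve \<Delta> e s)"

type_synonym 'e crossing = "('e \<times> real) \<times> ('e \<times> real)"

text \<open>The first component of a crossing is its overpass, the second its underpass.\<close>

definition crossings :: "('v, 'e) spatial \<Rightarrow> 'e crossing set"
  where "crossings \<Delta> = {((e, s), (f, u)) | e s f u.
    e \<in> arcs (graph \<Delta>) \<and> s \<in> {0<..<1} \<and> f \<in> arcs (graph \<Delta>) \<and> u \<in> {0<..<1} \<and>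
    shadow \<Delta> e s = shadow \<Delta> f u \<and> height (curve \<Delta> e s) > height (curve \<Delta> f u)}"

definition velocity :: "('v, 'e) spatial \<Rightarrow> 'e \<times> real \<Rightarrow> complex"
  where "velocity \<Delta> = (\<lambda>(e, s). vector_derivative (shadow \<Delta> e) (at s))"

text \<open>The cross product of the velocities of the overpass and the underpass: it is positive iff
  the underpass runs from the right of the overpass to its left.\<close>

definition crossing_cross :: "('v, 'e) spatial \<Rightarrow> 'e crossing \<Rightarrow> real"
  where "crossing_cross \<Delta> = (\<lambda>(p, q). Im (cnj (velocity \<Delta> p) * velocity \<Delta> q))"

text \<open>An end of an edge carries its local sign: \<open>1\<close> if directed into the vertex and \<open>-1\<close> if directed
  out of it, so a loop contributes two ends at its vertex.\<close>

type_synonym 'e arc_end = "'e \<times> int"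

definition vertex_ends :: "('v, 'e) pre_digraph \<Rightarrow> 'v \<Rightarrow> 'e arc_end set"
  where "vertex_ends G v = in_arcs G v \<times> {1} \<union> out_arcs G v \<times> {-1}"

text \<open>The direction in which an end leaves its vertex.\<close>

definition end_direction :: "('v, 'e) spatial \<Rightarrow> 'e arc_end \<Rightarrow> complex"
  where "end_direction \<Delta> = (\<lambda>(e, \<epsilon>).
    if \<epsilon> = 1 then - vector_derivative (shadow \<Delta> e) (at 1 within {0..1})
    else vector_derivative (shadow \<Delta> e) (at 0 within {0..1}))"

definition regular_projection :: "('v, 'e) spatial \<Rightarrow> bool"
  where "regular_projection \<Delta> \<longleftrightarrow>
    (\<forall>e\<in>arcs (graph \<Delta>). shadow \<Delta> e piecewise_C1_differentiable_on {0..1} \<and>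
       shadow \<Delta> e differentiable (at 0 within {0..1}) \<and>
       shadow \<Delta> e differentiable (at 1 within {0..1})) \<and>
    finite (crossings \<Delta>) \<and>
    (\<forall>x\<in>support \<Delta>. \<forall>y\<in>support \<Delta>. \<forall>z\<in>support \<Delta>.
       plane x = plane y \<and> plane y = plane z \<longrightarrow> x = y \<or> y = z \<or> x = z) \<and>
    (\<forall>v\<in>verts (graph \<Delta>). \<forall>x\<in>support \<Delta>. plane x = plane (point \<Delta> v) \<longrightarrow> x = point \<Delta> v) \<and>
    (\<forall>((e, s), (f, u))\<in>crossings \<Delta>. shadow \<Delta> e differentiable (at s) \<and>
       shadow \<Delta> f differentiable (at u) \<and> crossing_cross \<Delta> ((e, s), (f, u)) \<noteq> 0) \<and>
    (\<forall>v\<in>verts (graph \<Delta>). (\<forall>x\<in>vertex_ends (graph \<Delta>) v. end_direction \<Delta> x \<noteq> 0) \<and>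
       inj_on (\<lambda>x. sgn (end_direction \<Delta> x)) (vertex_ends (graph \<Delta>) v))"

text \<open>The arc \<open>(e, i)\<close> is the piece of \<open>e\<close> after exactly \<open>i\<close> of the undercrossings on \<open>e\<close>.\<close>

type_synonym 'e diagram_arc = "'e \<times> nat"

definition undercrossings :: "('v, 'e) spatial \<Rightarrow> 'e \<Rightarrow> real set"
  where "undercrossings \<Delta> e = {u. \<exists>p. (p, (e, u)) \<in> crossings \<Delta>}"

definition diagram_arcs :: "('v, 'e) spatial \<Rightarrow> 'e diagram_arc set"
  where "diagram_arcs \<Delta> = (SIGMA e:arcs (graph \<Delta>). {..card (undercrossings \<Delta> e)})"

definition arc_before :: "('v, 'e) spatial \<Rightarrow> 'e \<times> real \<Rightarrow> 'e diagram_arc"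
  where "arc_before \<Delta> = (\<lambda>(e, s). (e, card {u \<in> undercrossings \<Delta> e. u < s}))"

definition arc_after :: "('v, 'e) spatial \<Rightarrow> 'e \<times> real \<Rightarrow> 'e diagram_arc"
  where "arc_after \<Delta> = (\<lambda>(e, s). (e, card {u \<in> undercrossings \<Delta> e. u \<le> s}))"

definition arc_of_end :: "('v, 'e) spatial \<Rightarrow> 'e arc_end \<Rightarrow> 'e diagram_arc"
  where "arc_of_end \<Delta> = (\<lambda>(e, \<epsilon>). if \<epsilon> = 1 then arc_before \<Delta> (e, 1) else arc_after \<Delta> (e, 0))"

section \<open>The Alexander matrix\<close>

text \<open>In regular position the overpass is not itself an undercrossing, so \<open>arc_before\<close> and
  \<open>arc_after\<close> agree there.\<close>

definition overarc :: "('v, 'e) spatial \<Rightarrow> 'e crossing \<Rightarrow> 'e diagram_arc"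
  where "overarc \<Delta> = (\<lambda>(p, q). arc_before \<Delta> p)"

definition right_underarc :: "('v, 'e) spatial \<Rightarrow> 'e crossing \<Rightarrow> 'e diagram_arc"
  where "right_underarc \<Delta> = (\<lambda>(p, q).
    if crossing_cross \<Delta> (p, q) > 0 then arc_before \<Delta> q else arc_after \<Delta> q)"

definition left_underarc :: "('v, 'e) spatial \<Rightarrow> 'e crossing \<Rightarrow> 'e diagram_arc"
  where "left_underarc \<Delta> = (\<lambda>(p, q).
    if crossing_cross \<Delta> (p, q) > 0 then arc_after \<Delta> q else arc_before \<Delta> q)"

definition crossing_coeff ::
    "('v, 'e) spatial \<Rightarrow> ('e \<Rightarrow> int) \<Rightarrow> 'e crossing \<Rightarrow> 'e diagram_arc \<Rightarrow> laurent"
  where "crossing_coeff \<Delta> \<omega> c x =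
    (let w1 = \<omega> (fst (fst c)); w2 = \<omega> (fst (snd c)) in
     (if x = overarc \<Delta> c then 1 - t_pow w2 else 0)
     + (if x = left_underarc \<Delta> c then t_pow w1 else 0)
     - (if x = right_underarc \<Delta> c then 1 else 0))"

text \<open>\<open>clockwise_ends \<Delta> v xs\<close>: \<open>xs\<close> lists the ends at \<open>v\<close> in clockwise order starting at
  \<open>hd xs\<close>; \<open>Arg2pi (d / d')\<close> is the clockwise angle from \<open>d\<close> to \<open>d'\<close>.\<close>

definition clockwise_ends :: "('v, 'e) spatial \<Rightarrow> 'v \<Rightarrow> 'e arc_end list \<Rightarrow> bool"
  where "clockwise_ends \<Delta> v xs \<longleftrightarrow> set xs = vertex_ends (graph \<Delta>) v \<and>
    sorted_wrt (<) (map (\<lambda>x. Arg2pi (end_direction \<Delta> (hd xs) / end_direction \<Delta> x)) xs)"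

definition end_exponent :: "('e \<Rightarrow> int) \<Rightarrow> 'e arc_end list \<Rightarrow> nat \<Rightarrow> int"
  where "end_exponent \<omega> xs i =
    (\<Sum>j<i. snd (xs ! j) * \<omega> (fst (xs ! j))) + min (snd (xs ! i)) 0 * \<omega> (fst (xs ! i))"

definition vertex_coeff ::
    "('v, 'e) spatial \<Rightarrow> ('e \<Rightarrow> int) \<Rightarrow> 'e arc_end list \<Rightarrow> 'e diagram_arc \<Rightarrow> laurent"
  where "vertex_coeff \<Delta> \<omega> xs x =
    (\<Sum>i<length xs. if arc_of_end \<Delta> (xs ! i) = x
       then of_int (snd (xs ! i)) * t_pow (end_exponent \<omega> xs i) else 0)"

text \<open>The matrix of a diagram depends on the numbering \<open>cs\<close>, \<open>vs\<close>, \<open>as\<close> of crossings, vertices and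
  arcs, and on the clockwise lists \<open>xs v\<close>, hence on the starting points.\<close>

definition alexander_matrix :: "('v, 'e) spatial \<Rightarrow> ('e \<Rightarrow> int) \<Rightarrow> laurent Matrix.mat \<Rightarrow> bool"
  where "alexander_matrix \<Delta> \<omega> M \<longleftrightarrow> (\<exists>cs vs as xs.
    distinct cs \<and> set cs = crossings \<Delta> \<and>
    distinct vs \<and> set vs = verts (graph \<Delta>) \<and>
    distinct as \<and> set as = diagram_arcs \<Delta> \<and>
    (\<forall>v\<in>verts (graph \<Delta>). clockwise_ends \<Delta> v (xs v)) \<and>
    M = Matrix.mat (length cs + length vs) (length as) (\<lambda>(i, j).
      if i < length cs then crossing_coeff \<Delta> \<omega> (cs ! i) (as ! j)
      else vertex_coeff \<Delta> \<omega> (xs (vs ! (i - length cs))) (as ! j)))"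

text \<open>The \<open>k\<close>th Alexander polynomial, being defined only up to units, is the set of all Laurent
  polynomials representing it, over all diagrams of the spatial graph.  Independence of the diagram
  amounts to this set being at most a single class of associates.\<close>

definition alexander_polynomial ::
    "('v, 'e) spatial \<Rightarrow> ('e \<Rightarrow> int) \<Rightarrow> nat \<Rightarrow> laurent set"
  where "alexander_polynomial \<Gamma> \<omega> k = {p. \<exists>\<Delta> M.
    ambient_isotopic \<Gamma> \<Delta> \<and> regular_projection \<Delta> \<and> alexander_matrix \<Delta> \<omega> M \<and>
    is_minor_gcd M (int (dim_row M) - int k) p}"

end

theory Submission
  imports Defs
begin

text \<open>
  Reversing all edges and reflecting in a line of the plane both act on diagrams, and both have the
  same effect on the rows of the Alexander matrix: they exchange the two sides of every overarc.
  A crossing row \<open>(1 - t\<^sup>w\<^sup>2) b + t\<^sup>w\<^sup>1 c - a\<close> thereby becomes \<open>(1 - t\<^sup>w\<^sup>2) b + t\<^sup>w\<^sup>1 a - c\<close>.  The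
  substitution \<open>t \<mapsto> t\<^sup>-\<^sup>1\<close> in the old row, followed by multiplying each column by \<open>t\<^sup>-\<^sup>w\<close>, where \<open>w\<close> is
  the weight of its arc, and the row by \<open>- t\<^sup>w\<^sup>1\<^sup>+\<^sup>w\<^sup>2\<close>, gives exactly this new row.

  The same column factors serve at the vertices.  They turn the exponent \<open>m\<^sub>i\<close> into \<open>- m\<^sub>i - w\<^sub>i\<close>.
  Reversing the edges negates the local signs and keeps the clockwise order, and since
  \<open>- min(\<epsilon>, 0) - 1 = min(- \<epsilon>, 0)\<close> for \<open>\<epsilon> = \<plusminus>1\<close>, this is the exponent of the reversed diagram; the
  row changes by the factor \<open>-1\<close>.  A reflection keeps the signs and turns the clockwise order
  around, so partial sums of \<open>\<epsilon>\<^sub>i w\<^sub>i\<close> from the start become partial sums from the end.  Balance says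
  that the sum over all ends is \<open>0\<close>, hence the latter are the negated former, and the exponent is
  again \<open>- m\<^sub>i - w\<^sub>i\<close>.

  So the new matrix is the old one with \<open>t\<close> inverted, up to unit factors of rows and columns
  (\<open>alexander_matrix_inverse_graph\<close>, \<open>alexander_matrix_mirror\<close>).  Such factors change every minor
  by a unit only, and the greatest common divisors correspond under \<open>t \<mapsto> t\<^sup>-\<^sup>1\<close>
  (\<open>is_minor_gcd_unit_scaled_inversion\<close>).

  An Alexander polynomial is represented by the set of its values over all diagrams of the isotopy
  class, so it remains that both operations on diagrams respect ambient isotopy
  (\<open>ambient_isotopic_inverse_graph\<close>, \<open>ambient_isotopic_image_graph\<close>).  Both are involutions, which
  gives the converse inclusions between the sets.
\<close>

section \<open>Inverting t in determinantal divisors\<close>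

lemma lookup_invert_t: "Poly_Mapping.lookup (invert_t p) r = Poly_Mapping.lookup p (- r)"
  by (simp add: invert_t_def map_key.rep_eq)

lemma invert_t_single: "invert_t (Poly_Mapping.single r c) = Poly_Mapping.single (- r) c"
  by (rule poly_mapping_eqI) (auto simp: lookup_invert_t lookup_single when_def)

lemma invert_t_t_pow [simp]: "invert_t (t_pow r) = t_pow (- r)"
  by (simp add: t_pow_def invert_t_single)

lemma invert_t_invert_t [simp]: "invert_t (invert_t p) = p"
  by (rule poly_mapping_eqI) (simp add: lookup_invert_t)

lemma invert_t_add: "invert_t (p + q) = invert_t p + invert_t q"
  by (rule poly_mapping_eqI) (simp add: lookup_invert_t lookup_add)

lemma invert_t_diff: "invert_t (p - q) = invert_t p - invert_t q"
  by (rule poly_mapping_eqI) (simp add: lookup_invert_t lookup_minus)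

text \<open>The powers of \<open>t\<close> generate the additive group of Laurent polynomials, so additive statements need
  to be checked on them only.\<close>

lemma laurent_induct [case_names zero t_pow diff]:
  assumes "P 0" and "\<And>r. P (t_pow r)" and "\<And>p q. P p \<Longrightarrow> P q \<Longrightarrow> P (p - q)"
  shows "P p"
  using frag_induction[of p UNIV P] assms by (simp add: t_pow_def)

lemma t_pow_0 [simp]: "t_pow 0 = 1"
  by (simp add: t_pow_def)

lemma t_pow_add: "t_pow (r + s) = t_pow r * t_pow s"
  by (simp add: t_pow_def mult_single)

lemma invert_t_0: "invert_t 0 = 0"
  by (rule poly_mapping_eqI) (simp add: lookup_invert_t)

lemma invert_t_mult: "invert_t (p * q) = invert_t p * invert_t q"
proof (induction p rule: laurent_induct)
  case (t_pow r)
  show ?case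
    by (induction q rule: laurent_induct)
      (simp_all add: invert_t_0 invert_t_diff right_diff_distrib flip: t_pow_add)
qed (simp_all add: invert_t_0 invert_t_diff left_diff_distrib)

interpretation invert_t: comm_ring_hom invert_t
proof
  show "invert_t 1 = 1"
    using invert_t_t_pow[of 0] by simp
qed (simp_all add: invert_t_0 invert_t_add invert_t_mult)

lemma invert_t_dvd_iff: "invert_t p dvd invert_t q \<longleftrightarrow> p dvd q"
  by (metis invert_t.hom_dvd invert_t_invert_t)

lemma t_pow_dvd_1: "t_pow r dvd 1"
  by (rule dvdI[of _ _ "t_pow (- r)"]) (simp flip: t_pow_add)

text \<open>In each term of the Leibniz expansion every row and every column occurs once.\<close>

lemma det_scale_rows_cols:
  fixes A :: "'a::comm_ring_1 Matrix.mat"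
  assumes "A \<in> carrier_mat n n"
  shows "Determinant.det (Matrix.mat n n (\<lambda>(i, j). r i * c j * A $$ (i, j))) =
    prod r {0..<n} * prod c {0..<n} * Determinant.det A"
proof -
  have "(\<Prod>i = 0..<n. r i * c (\<pi> i) * A $$ (i, \<pi> i)) =
      prod r {0..<n} * prod c {0..<n} * (\<Prod>i = 0..<n. A $$ (i, \<pi> i))"
    if "\<pi> permutes {0..<n}" for \<pi>
    using prod.permute[OF that, of c] by (simp add: prod.distrib o_def)
  moreover have "(i, \<pi> i) \<in> {0..<n} \<times> {0..<n}" if "\<pi> permutes {0..<n}" "i < n" for \<pi> i
    using permutes_in_image[OF that(1), of i] that(2) by auto
  ultimately show ?thesis
    using assms
    by (auto simp: Determinant.det_def sum_distrib_left mult.left_commute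
        intro!: sum.cong prod.cong)
qed

lemma prod_dvd_1:
  fixes f :: "'b \<Rightarrow> 'a::comm_ring_1"
  assumes "\<And>i. i \<in> S \<Longrightarrow> f i dvd 1"
  shows "prod f S dvd 1"
  using prod_dvd_prod[of S f "\<lambda>_. 1"] assms by simp

text \<open>The relation between the Alexander matrices of a diagram and of its reversal or reflection: \<open>M'\<close> is
  \<open>M(t\<^sup>-\<^sup>1)\<close> up to unit factors of rows and columns, with the numberings of both matrices matched.\<close>

definition unit_scaled_inversion :: "laurent Matrix.mat \<Rightarrow> laurent Matrix.mat \<Rightarrow> bool"
  where "unit_scaled_inversion M M' \<longleftrightarrow>
    dim_row M' = dim_row M \<and> dim_col M' = dim_col M \<and>
    (\<exists>r c. (\<forall>i. r i dvd 1) \<and> (\<forall>j. c j dvd 1) \<and>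
      (\<forall>i<dim_row M. \<forall>j<dim_col M. M' $$ (i, j) = r i * c j * invert_t (M $$ (i, j))))"

lemma minor_unit_scaled_inversion:
  assumes "unit_scaled_inversion M M'"
    and I: "I \<subseteq> {..<dim_row M}" and J: "J \<subseteq> {..<dim_col M}" and "card I = card J"
  shows "\<exists>u. u dvd 1 \<and> Determinant.det (submatrix M' I J) =
    u * invert_t (Determinant.det (submatrix M I J))"
proof -
  obtain r c where dims: "dim_row M' = dim_row M" "dim_col M' = dim_col M"
    and r: "\<And>i. r i dvd 1" and c: "\<And>j. c j dvd 1"
    and M': "\<And>i j. i < dim_row M \<Longrightarrow> j < dim_col M \<Longrightarrow>
      M' $$ (i, j) = r i * c j * invert_t (M $$ (i, j))"
    using assms(1) unfolding unit_scaled_inversion_def by blast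
  define n where "n = card I"
  have IJ: "{i. i < dim_row M \<and> i \<in> I} = I" "{j. j < dim_col M \<and> j \<in> J} = J"
    using I J by auto
  let ?N = "map_mat invert_t (submatrix M I J)"
  have N: "?N \<in> carrier_mat n n"
    using assms(4) by (intro carrier_matI) (simp_all add: n_def dim_submatrix IJ)
  have "submatrix M' I J =
      Matrix.mat n n (\<lambda>(i, j). r (pick I i) * c (pick J j) * ?N $$ (i, j))"
  proof (rule eq_matI)
    fix i j
    assume "i < dim_row (Matrix.mat n n (\<lambda>(i, j). r (pick I i) * c (pick J j) * ?N $$ (i, j)))"
      and "j < dim_col (Matrix.mat n n (\<lambda>(i, j). r (pick I i) * c (pick J j) * ?N $$ (i, j)))"
    then have ij: "i < n" "j < n" by simp_all
    have "pick I i < dim_row M" "pick J j < dim_col M"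
      using pick_in_set_le[of i I] pick_in_set_le[of j J] I J assms(4) ij
      by (auto simp: n_def)
    then show "submatrix M' I J $$ (i, j) =
        Matrix.mat n n (\<lambda>(i, j). r (pick I i) * c (pick J j) * ?N $$ (i, j)) $$ (i, j)"
      using ij assms(4) by (simp add: submatrix_def IJ dims M' n_def)
  qed (use assms(4) in \<open>simp_all add: dim_submatrix IJ dims n_def\<close>)
  then have "Determinant.det (submatrix M' I J) =
      (\<Prod>i = 0..<n. r (pick I i)) * (\<Prod>j = 0..<n. c (pick J j)) *
      invert_t (Determinant.det (submatrix M I J))"
    using det_scale_rows_cols[OF N, of "\<lambda>i. r (pick I i)" "\<lambda>j. c (pick J j)"] by simp
  moreover have "(\<Prod>i = 0..<n. r (pick I i)) * (\<Prod>j = 0..<n. c (pick J j)) dvd 1"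
    using mult_dvd_mono[OF prod_dvd_1 prod_dvd_1, of "{0..<n}" "\<lambda>i. r (pick I i)" "{0..<n}" "\<lambda>j. c (pick J j)"] r c
    by simp
  ultimately show ?thesis by blast
qed

text \<open>The automorphism \<open>t \<mapsto> t\<^sup>-\<^sup>1\<close> maps common divisors to common divisors.  Comparing divisors rather
  than elements leaves room for unit factors.\<close>

lemma is_gcd_of_invert_t:
  assumes "is_gcd_of g S" and "\<And>d. (\<forall>m\<in>S'. d dvd m) \<longleftrightarrow> (\<forall>m\<in>S. d dvd invert_t m)"
  shows "is_gcd_of (invert_t g) S'"
  using assms unfolding is_gcd_of_def by (metis invert_t_dvd_iff invert_t_invert_t)

lemma unit_mult_dvd_iff:
  fixes u :: "'a::comm_ring_1" assumes "u dvd 1" shows "d dvd u * m \<longleftrightarrow> d dvd m"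
proof -
  obtain v where "u * v = 1" using assms by (metis dvdE)
  then have "m = v * (u * m)" by (simp add: ac_simps flip: mult.assoc)
  then show ?thesis by (metis dvd_mult)
qed

text \<open>Corresponding minors are associates after inverting \<open>t\<close>, so they have the same divisors.\<close>

lemma is_minor_gcd_unit_scaled_inversion:
  assumes "unit_scaled_inversion M M'" and "is_minor_gcd M k g"
  shows "is_minor_gcd M' k (invert_t g)"
proof -
  have dims: "dim_row M' = dim_row M" "dim_col M' = dim_col M"
    using assms(1) by (auto simp: unit_scaled_inversion_def)
  have minors: "d dvd Determinant.det (submatrix M' I J) \<longleftrightarrow>
      d dvd invert_t (Determinant.det (submatrix M I J))"
    if "I \<subseteq> {..<dim_row M}" "J \<subseteq> {..<dim_col M}" "card I = card J" for I J d
    using minor_unit_scaled_inversion[OF assms(1) that] by (metis unit_mult_dvd_iff)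
  have "(\<forall>m\<in>minors M' n. d dvd m) \<longleftrightarrow> (\<forall>m\<in>minors M n. d dvd invert_t m)" for n d
  proof -
    let ?K = "{(I, J). I \<subseteq> {..<dim_row M} \<and> J \<subseteq> {..<dim_col M} \<and> card I = n \<and> card J = n}"
    have image: "minors N n = (\<lambda>(I, J). Determinant.det (submatrix N I J)) ` ?K"
      if "dim_row N = dim_row M" "dim_col N = dim_col M" for N :: "laurent Matrix.mat"
      using that by (auto simp: minors_def image_def)
    show ?thesis
      unfolding image[OF dims] image[OF refl refl] ball_simps
      by (intro all_cong) (auto simp: minors)
  qed
  then show ?thesis
    using assms(2) unfolding is_minor_gcd_def
    by (auto intro!: is_gcd_of_invert_t split: if_splits)
qed

section \<open>Transport of Alexander matrices between diagrams\<close>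

text \<open>The bookkeeping shared by reversal and reflection.  The numberings of crossings and arcs are
  carried along \<open>\<kappa>\<close> and \<open>\<alpha>\<close> and the clockwise lists along \<open>f\<close>, so that the assumptions on single
  coefficients become an entrywise relation of matrices; \<open>\<delta>\<close> is the factor of the vertex rows.\<close>

lemma alexander_matrix_transport:
  assumes \<kappa>: "bij_betw \<kappa> (crossings \<Delta>) (crossings \<Delta>')"
    and \<alpha>: "bij_betw \<alpha> (diagram_arcs \<Delta>) (diagram_arcs \<Delta>')"
    and verts: "verts (graph \<Delta>') = verts (graph \<Delta>)"
    and crossing: "\<And>c x. c \<in> crossings \<Delta> \<Longrightarrow> x \<in> diagram_arcs \<Delta> \<Longrightarrow>
      crossing_coeff \<Delta>' \<omega> (\<kappa> c) (\<alpha> x) =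
        - t_pow (\<omega> (fst (fst c)) + \<omega> (fst (snd c))) * t_pow (- \<omega> (fst x)) *
          invert_t (crossing_coeff \<Delta> \<omega> c x)"
    and ends: "\<And>v xs. v \<in> verts (graph \<Delta>) \<Longrightarrow> clockwise_ends \<Delta> v xs \<Longrightarrow>
      clockwise_ends \<Delta>' v (f xs)"
    and vertex: "\<And>v xs x. v \<in> verts (graph \<Delta>) \<Longrightarrow> clockwise_ends \<Delta> v xs \<Longrightarrow>
      x \<in> diagram_arcs \<Delta> \<Longrightarrow> vertex_coeff \<Delta>' \<omega> (f xs) (\<alpha> x) =
        \<delta> * t_pow (- \<omega> (fst x)) * invert_t (vertex_coeff \<Delta> \<omega> xs x)"
    and "\<delta> dvd 1"
    and "alexander_matrix \<Delta> \<omega> M"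
  obtains M' where "alexander_matrix \<Delta>' \<omega> M'" and "unit_scaled_inversion M M'"
proof -
  obtain cs vs as xs where cs: "distinct cs" "set cs = crossings \<Delta>"
    and vs: "distinct vs" "set vs = verts (graph \<Delta>)"
    and as: "distinct as" "set as = diagram_arcs \<Delta>"
    and xs: "\<forall>v\<in>verts (graph \<Delta>). clockwise_ends \<Delta> v (xs v)"
    and M: "M = Matrix.mat (length cs + length vs) (length as) (\<lambda>(i, j).
      if i < length cs then crossing_coeff \<Delta> \<omega> (cs ! i) (as ! j)
      else vertex_coeff \<Delta> \<omega> (xs (vs ! (i - length cs))) (as ! j))"
    using assms(8) unfolding alexander_matrix_def by (elim exE conjE) (rule that)
  define M' where "M' = Matrix.mat (length (map \<kappa> cs) + length vs) (length (map \<alpha> as)) (\<lambda>(i, j).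
      if i < length (map \<kappa> cs) then crossing_coeff \<Delta>' \<omega> (map \<kappa> cs ! i) (map \<alpha> as ! j)
      else vertex_coeff \<Delta>' \<omega> (f (xs (vs ! (i - length (map \<kappa> cs))))) (map \<alpha> as ! j))"
  have "distinct (map \<kappa> cs)" "set (map \<kappa> cs) = crossings \<Delta>'"
    "distinct (map \<alpha> as)" "set (map \<alpha> as) = diagram_arcs \<Delta>'"
    using \<kappa> \<alpha> cs as by (auto simp: distinct_map bij_betw_def)
  moreover have "\<forall>v\<in>verts (graph \<Delta>'). clockwise_ends \<Delta>' v (f (xs v))"
    using ends xs verts by simp
  ultimately have "alexander_matrix \<Delta>' \<omega> M'"
    unfolding alexander_matrix_def M'_def using vs verts
    by (intro exI[of _ "map \<kappa> cs"] exI[of _ vs] exI[of _ "map \<alpha> as"] exI[of _ "\<lambda>v. f (xs v)"]) simp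
  moreover have "unit_scaled_inversion M M'"
    unfolding unit_scaled_inversion_def
  proof (intro conjI exI allI impI)
    let ?r = "\<lambda>i. if i < length cs
      then - t_pow (\<omega> (fst (fst (cs ! i))) + \<omega> (fst (snd (cs ! i)))) else \<delta>"
    let ?c = "\<lambda>j. t_pow (- \<omega> (fst (as ! j)))"
    show "?r i dvd 1" for i using t_pow_dvd_1 assms(7) by simp
    show "?c j dvd 1" for j by (rule t_pow_dvd_1)
    fix i j assume "i < dim_row M" "j < dim_col M"
    then have ij: "i < length cs + length vs" "j < length as" by (simp_all add: M)
    have j: "as ! j \<in> diagram_arcs \<Delta>" using ij as nth_mem by metis
    show "M' $$ (i, j) = ?r i * ?c j * invert_t (M $$ (i, j))"
    proof (cases "i < length cs")
      case True
      then have "cs ! i \<in> crossings \<Delta>" using cs nth_mem by metis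
      then show ?thesis using True ij j by (simp add: M M'_def crossing)
    next
      case False
      then have "vs ! (i - length cs) \<in> verts (graph \<Delta>)" using ij vs
        by (metis add_diff_inverse_nat nat_add_left_cancel_less nth_mem)
      then show ?thesis using False ij j by (simp add: M M'_def vertex[OF _ xs[rule_format]])
    qed
  qed (simp_all add: M M'_def)
  ultimately show ?thesis using that by blast
qed

lemma fst_arc_before [simp]: "fst (arc_before \<Delta> p) = fst p"
  by (simp add: arc_before_def split: prod.split)

lemma fst_arc_after [simp]: "fst (arc_after \<Delta> p) = fst p"
  by (simp add: arc_after_def split: prod.split)

lemma fst_arc_of_end [simp]: "fst (arc_of_end \<Delta> x) = fst x"
  by (simp add: arc_of_end_def split: prod.split)

lemma fst_overarc [simp]: "fst (overarc \<Delta> c) = fst (fst c)"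
  by (simp add: overarc_def split: prod.split)

lemma fst_left_underarc [simp]: "fst (left_underarc \<Delta> c) = fst (snd c)"
  by (simp add: left_underarc_def split: prod.split)

lemma fst_right_underarc [simp]: "fst (right_underarc \<Delta> c) = fst (snd c)"
  by (simp add: right_underarc_def split: prod.split)

text \<open>Exchanging the sides of the overarc amounts to inverting \<open>t\<close>, up to units.  Before the column factor,
  the overarc has coefficient \<open>1 - t\<^sup>-\<^sup>w\<^sup>2\<close> and its column has weight \<open>w\<^sub>1\<close>, so the total factor
  there is \<open>- t\<^sup>w\<^sup>2\<close> and yields \<open>1 - t\<^sup>w\<^sup>2\<close>; on both underarcs the total factor is \<open>- t\<^sup>w\<^sup>1\<close>,
  which turns \<open>t\<^sup>-\<^sup>w\<^sup>1\<close> into \<open>-1\<close> and \<open>-1\<close> into \<open>t\<^sup>w\<^sup>1\<close>.\<close>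

lemma crossing_coeff_swap_sides:
  assumes \<alpha>: "inj_on \<alpha> A"
    and "x \<in> A" "overarc \<Delta> c \<in> A" "left_underarc \<Delta> c \<in> A" "right_underarc \<Delta> c \<in> A"
    and "overarc \<Delta>' c' = \<alpha> (overarc \<Delta> c)"
    and "left_underarc \<Delta>' c' = \<alpha> (right_underarc \<Delta> c)"
    and "right_underarc \<Delta>' c' = \<alpha> (left_underarc \<Delta> c)"
    and "fst (fst c') = fst (fst c)" "fst (snd c') = fst (snd c)"
  shows "crossing_coeff \<Delta>' \<omega> c' (\<alpha> x) =
    - t_pow (\<omega> (fst (fst c)) + \<omega> (fst (snd c))) * t_pow (- \<omega> (fst x)) *
      invert_t (crossing_coeff \<Delta> \<omega> c x)"
proof -
  define w1 w2 where w: "w1 = \<omega> (fst (fst c))" "w2 = \<omega> (fst (snd c))"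
  let ?u = "- t_pow (w1 + w2) * t_pow (- \<omega> (fst x))"
  have \<alpha>_eq: "\<alpha> x = \<alpha> y \<longleftrightarrow> x = y" if "y \<in> A" for y
    using inj_on_eq_iff[OF \<alpha> \<open>x \<in> A\<close> that] .
  \<comment> \<open>The three contributions are compared separately, because the arcs of a crossing may coincide.\<close>
  have over: "(if x = overarc \<Delta> c then 1 - t_pow w2 else 0) =
      ?u * invert_t (if x = overarc \<Delta> c then 1 - t_pow w2 else 0)"
    by (simp add: w(1) invert_t_diff invert_t_0 invert_t.hom_one right_diff_distrib flip: t_pow_add)
  have left: "(if x = left_underarc \<Delta> c then - 1 else 0) =
      ?u * invert_t (if x = left_underarc \<Delta> c then t_pow w1 else 0)"
    by (simp add: w(2) invert_t_0 flip: t_pow_add)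
  have right: "(if x = right_underarc \<Delta> c then - t_pow w1 else 0) =
      ?u * invert_t (if x = right_underarc \<Delta> c then 1 else 0)"
    by (simp add: w(2) invert_t_0 invert_t.hom_one flip: t_pow_add)
  have "crossing_coeff \<Delta>' \<omega> c' (\<alpha> x) =
      (if x = overarc \<Delta> c then 1 - t_pow w2 else 0)
      + (if x = left_underarc \<Delta> c then - 1 else 0)
      - (if x = right_underarc \<Delta> c then - t_pow w1 else 0)"
    by (simp add: crossing_coeff_def Let_def assms(3-10) \<alpha>_eq w)
  also have "\<dots> = ?u * invert_t (crossing_coeff \<Delta> \<omega> c x)"
    by (subst over, subst left, subst right)
      (simp only: crossing_coeff_def Let_def w invert_t_add invert_t_diff distrib_left right_diff_distrib)
  finally show ?thesis by (simp add: w)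
qed

text \<open>The column factor \<open>t\<^sup>-\<^sup>w\<close> shifts each exponent by the weight of its end, since an arc has the weight
  of its edge.  The permutation \<open>\<pi>\<close> allows the new list to run through the ends in another order,
  and \<open>s\<close> is the common change of the local signs.\<close>

lemma vertex_coeff_invert_exponents:
  assumes \<alpha>: "inj_on \<alpha> A" and "x \<in> A"
    and "\<And>y. y \<in> set xs \<Longrightarrow> arc_of_end \<Delta> y \<in> A"
    and len: "length ys = length xs" and \<pi>: "bij_betw \<pi> {..<length xs} {..<length xs}"
    and "\<And>i. i < length xs \<Longrightarrow> arc_of_end \<Delta>' (ys ! \<pi> i) = \<alpha> (arc_of_end \<Delta> (xs ! i))"
    and "\<And>i. i < length xs \<Longrightarrow> snd (ys ! \<pi> i) = s * snd (xs ! i)"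
    and "\<And>i. i < length xs \<Longrightarrow>
      end_exponent \<omega> ys (\<pi> i) = - end_exponent \<omega> xs i - \<omega> (fst (xs ! i))"
  shows "vertex_coeff \<Delta>' \<omega> ys (\<alpha> x) =
    of_int s * t_pow (- \<omega> (fst x)) * invert_t (vertex_coeff \<Delta> \<omega> xs x)"
proof -
  have "vertex_coeff \<Delta>' \<omega> ys (\<alpha> x) =
      (\<Sum>i<length xs. if arc_of_end \<Delta>' (ys ! \<pi> i) = \<alpha> x
        then of_int (snd (ys ! \<pi> i)) * t_pow (end_exponent \<omega> ys (\<pi> i)) else 0)"
    unfolding vertex_coeff_def len by (rule sum.reindex_bij_betw[OF \<pi>, symmetric])
  also have "\<dots> = (\<Sum>i<length xs. of_int s * t_pow (- \<omega> (fst x)) *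
      invert_t (if arc_of_end \<Delta> (xs ! i) = x
        then of_int (snd (xs ! i)) * t_pow (end_exponent \<omega> xs i) else 0))"
  proof (rule sum.cong[OF refl])
    fix i assume "i \<in> {..<length xs}"
    then have i: "i < length xs" by simp
    then have iff: "arc_of_end \<Delta>' (ys ! \<pi> i) = \<alpha> x \<longleftrightarrow> arc_of_end \<Delta> (xs ! i) = x"
      using inj_on_eq_iff[OF \<alpha>] assms(2,3,6) by simp
    show "(if arc_of_end \<Delta>' (ys ! \<pi> i) = \<alpha> x
        then of_int (snd (ys ! \<pi> i)) * t_pow (end_exponent \<omega> ys (\<pi> i)) else 0) =
      of_int s * t_pow (- \<omega> (fst x)) * invert_t (if arc_of_end \<Delta> (xs ! i) = x
        then of_int (snd (xs ! i)) * t_pow (end_exponent \<omega> xs i) else 0)"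
    proof (cases "arc_of_end \<Delta> (xs ! i) = x")
      case True
      then have "fst (xs ! i) = fst x" using fst_arc_of_end by metis
      then have "end_exponent \<omega> ys (\<pi> i) = - \<omega> (fst x) + - end_exponent \<omega> xs i"
        using assms(8)[OF i] by simp
      then have "of_int (snd (ys ! \<pi> i)) * t_pow (end_exponent \<omega> ys (\<pi> i)) =
          of_int s * t_pow (- \<omega> (fst x)) *
            (of_int (snd (xs ! i)) * t_pow (- end_exponent \<omega> xs i))"
        unfolding assms(7)[OF i] by (simp only: t_pow_add of_int_mult mult.assoc mult.left_commute)
      then show ?thesis
        by (simp add: True iff invert_t_mult invert_t.hom_of_int)
    qed (simp add: iff invert_t_0)
  qed
  also have "\<dots> = of_int s * t_pow (- \<omega> (fst x)) * invert_t (vertex_coeff \<Delta> \<omega> xs x)"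
    unfolding vertex_coeff_def by (simp only: sum_distrib_left invert_t.hom_sum)
  finally show ?thesis .
qed

section \<open>Reflections, reversal and ambient isotopy\<close>

definition reflection :: "real^3 \<Rightarrow> real^3 \<Rightarrow> real^3 \<Rightarrow> real^3"
  where "reflection a n x = x - (2 * (inner (x - a) n) / (inner n n)) *\<^sub>R n"

lemma plane_reflection_iff: "plane_reflection \<rho> \<longleftrightarrow> (\<exists>a n. n \<noteq> 0 \<and> \<rho> = reflection a n)"
  by (simp add: plane_reflection_def reflection_def fun_eq_iff)

lemma reflection_involution: "n \<noteq> 0 \<Longrightarrow> reflection a n (reflection a n x) = x"
proof -
  assume "n \<noteq> 0"
  then have "inner (reflection a n x - a) n = - inner (x - a) n"
    by (simp add: reflection_def inner_diff_left)
  then show ?thesis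
    using reflection_def[of a n "reflection a n x"] reflection_def[of a n x] by simp
qed

lemma reflection_minus_normal: "reflection a (- n) = reflection a n"
  by (simp add: reflection_def fun_eq_iff)

lemma homeomorphism_reflection:
  assumes "n \<noteq> 0"
  shows "homeomorphism UNIV UNIV (reflection a n) (reflection a n)"
proof -
  have "continuous_on UNIV (reflection a n)"
    unfolding reflection_def using assms by (intro continuous_intros) auto
  then show ?thesis
    using assms by (intro homeomorphismI) (auto simp: reflection_involution)
qed

text \<open>One plane is moved to the other by moving a point of it and a normal along segments.\<close>

lemma reflection_path:
  assumes "plane_reflection \<rho>" "plane_reflection \<sigma>"
  obtains a n :: "real \<Rightarrow> real^3" where "continuous_on {0..1} a" "continuous_on {0..1} n"
    "\<And>t. t \<in> {0..1} \<Longrightarrow> n t \<noteq> 0" "reflection (a 0) (n 0) = \<rho>" "reflection (a 1) (n 1) = \<sigma>"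
proof -
  obtain a0 m0 a1 n1 where m0: "m0 \<noteq> 0" "\<rho> = reflection a0 m0"
    and n1: "n1 \<noteq> 0" "\<sigma> = reflection a1 n1"
    using assms unfolding plane_reflection_iff by blast
  \<comment> \<open>A normal may be replaced by its negative, and the segment between two normals avoids the origin
    when their angle is not obtuse.\<close>
  define n0 where "n0 = (if inner m0 n1 \<ge> 0 then m0 else - m0)"
  have n0: "n0 \<noteq> 0" "\<rho> = reflection a0 n0" "inner n0 n1 \<ge> 0"
    using m0 by (auto simp: n0_def reflection_minus_normal)
  show thesis
  proof
    fix t :: real assume t: "t \<in> {0..1}"
    show "(1 - t) *\<^sub>R n0 + t *\<^sub>R n1 \<noteq> 0"
    proof
      assume 0: "(1 - t) *\<^sub>R n0 + t *\<^sub>R n1 = 0"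
      have "t * inner n1 n1 + (1 - t) * inner n0 n1 = 0"
        using arg_cong[OF 0, of "\<lambda>x. inner x n1"] by (simp add: inner_add_left)
      moreover have "t * inner n1 n1 \<ge> 0" "(1 - t) * inner n0 n1 \<ge> 0"
        using t n0(3) by auto
      ultimately have "t = 0" using n1(1) by (simp add: add_nonneg_eq_0_iff)
      then show False using 0 n0(1) by simp
    qed
  next
    show "continuous_on {0..1} (\<lambda>t. (1 - t) *\<^sub>R a0 + t *\<^sub>R a1)"
      "continuous_on {0..1} (\<lambda>t. (1 - t) *\<^sub>R n0 + t *\<^sub>R n1)"
      by (intro continuous_intros)+
  qed (simp_all add: n0 n1)
qed

text \<open>The mirror image may be formed with one reflection and the diagram reflected by another.  If \<open>h\<^sub>t\<close> is
  the given isotopy and \<open>\<rho>\<^sub>t\<close> a path of reflections from \<open>\<rho>\<close> to \<open>\<sigma>\<close>, then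
  \<open>\<rho>\<^sub>t \<circ> h\<^sub>t \<circ> \<rho>\<close> runs from \<open>\<rho> \<circ> \<rho> = id\<close> to \<open>\<sigma> \<circ> h\<^sub>1 \<circ> \<rho>\<close>, which carries the image of
  \<open>\<Gamma>\<close> under \<open>\<rho>\<close> to the image of \<open>\<Delta>\<close> under \<open>\<sigma>\<close>.\<close>

lemma ambient_isotopic_image_graph:
  assumes "ambient_isotopic \<Gamma> \<Delta>" and \<rho>: "plane_reflection \<rho>" and \<sigma>: "plane_reflection \<sigma>"
  shows "ambient_isotopic (image_graph \<rho> \<Gamma>) (image_graph \<sigma> \<Delta>)"
proof -
  let ?homeo = "\<lambda>f :: real^3 \<Rightarrow> real^3. \<exists>g. homeomorphism UNIV UNIV f g"
  obtain h where h: "homotopic_with_canon ?homeo UNIV UNIV id h"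
    and graph: "graph \<Delta> = graph \<Gamma>"
    and point: "\<And>v. v \<in> verts (graph \<Gamma>) \<Longrightarrow> point \<Delta> v = h (point \<Gamma> v)"
    and curve: "\<forall>e\<in>arcs (graph \<Gamma>). \<exists>\<phi>. strict_mono_on {0..1} \<phi> \<and> continuous_on {0..1} \<phi> \<and>
      \<phi> ` {0..1} = {0..1} \<and> (\<forall>s\<in>{0..1}. curve \<Delta> e s = h (curve \<Gamma> e (\<phi> s)))"
    using assms(1) unfolding ambient_isotopic_def by blast
  obtain a n :: "real \<Rightarrow> real^3" where a: "continuous_on {0..1} a" and n: "continuous_on {0..1} n"
    and n0: "\<And>t. t \<in> {0..1} \<Longrightarrow> n t \<noteq> 0"
    and ends: "reflection (a 0) (n 0) = \<rho>" "reflection (a 1) (n 1) = \<sigma>"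
    using reflection_path[OF \<rho> \<sigma>] by blast
  have "\<exists>H :: real \<times> (real^3) \<Rightarrow> real^3. continuous_on ({0..1} \<times> UNIV) H \<and>
      (\<forall>x. H (0, x) = x) \<and> (\<forall>x. H (1, x) = h x) \<and> (\<forall>t\<in>{0..1}. ?homeo (\<lambda>x. H (t, x)))"
    using h unfolding homotopic_with_def prod_topology_subtopology_eu by simp
  then obtain H :: "real \<times> (real^3) \<Rightarrow> real^3" where H: "continuous_on ({0..1} \<times> UNIV) H"
    and H0: "\<And>x. H (0, x) = x" and H1: "\<And>x. H (1, x) = h x"
    and H_homeo: "\<And>t. t \<in> {0..1} \<Longrightarrow> ?homeo (\<lambda>x. H (t, x))"
    by blast
  have \<rho>_inv: "\<rho> (\<rho> x) = x" for x
    using reflection_involution[OF n0[of 0]] ends by auto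
  have \<rho>_homeo: "homeomorphism UNIV UNIV \<rho> \<rho>"
    using homeomorphism_reflection[OF n0[of 0], of "a 0"] ends by auto
  define K where "K = (\<lambda>(t, x). reflection (a t) (n t) (H (t, \<rho> x)))"
  have "continuous_on ({0..1} \<times> UNIV) K"
  proof -
    have "continuous_on UNIV \<rho>" using \<rho>_homeo by (simp add: homeomorphism_def)
    then have "continuous_on ({0..1} \<times> UNIV) (\<lambda>p :: real \<times> (real^3). \<rho> (snd p))"
      by (rule continuous_on_compose2) (auto intro: continuous_on_snd continuous_on_id)
    then have "continuous_on ({0..1} \<times> UNIV) (\<lambda>p :: real \<times> (real^3). (fst p, \<rho> (snd p)))"
      by (intro continuous_on_Pair continuous_on_fst continuous_on_id)
    then have "continuous_on ({0..1} \<times> UNIV) (\<lambda>p. H (fst p, \<rho> (snd p)))"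
      by (rule continuous_on_compose2[OF H]) auto
    moreover have "continuous_on ({0..1} \<times> UNIV) (\<lambda>p :: real \<times> (real^3). a (fst p))"
      by (rule continuous_on_compose2[OF a]) (auto intro: continuous_on_fst continuous_on_id)
    moreover have "continuous_on ({0..1} \<times> UNIV) (\<lambda>p :: real \<times> (real^3). n (fst p))"
      by (rule continuous_on_compose2[OF n]) (auto intro: continuous_on_fst continuous_on_id)
    ultimately show ?thesis
      unfolding K_def reflection_def case_prod_unfold
      by (intro continuous_intros) (use n0 in auto)
  qed
  moreover have "?homeo (\<lambda>x. K (t, x))" if t: "t \<in> {0..1}" for t
  proof -
    obtain g where "homeomorphism UNIV UNIV (\<lambda>x. H (t, x)) g" using H_homeo[OF t] by blast
    from homeomorphism_compose[OF homeomorphism_compose[OF \<rho>_homeo this]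
        homeomorphism_reflection[OF n0[OF t], of "a t"]]
    show ?thesis by (auto simp: K_def o_def)
  qed
  moreover have "K (0, x) = x" "K (1, x) = (\<sigma> \<circ> h \<circ> \<rho>) x" for x
    using ends by (simp_all add: K_def H0 H1 \<rho>_inv)
  ultimately have "homotopic_with_canon ?homeo UNIV UNIV id (\<sigma> \<circ> h \<circ> \<rho>)"
    unfolding homotopic_with_def prod_topology_subtopology_eu
    by (intro exI[of _ K]) simp
  then show ?thesis
    unfolding ambient_isotopic_def image_graph_def
    using graph point curve
    by (intro conjI exI[of _ "\<sigma> \<circ> h \<circ> \<rho>"]) (simp_all add: \<rho>_inv, metis)
qed

text \<open>The same ambient isotopy works; a reparametrisation \<open>\<phi>\<close> of an edge becomes \<open>1 - \<phi>(1 - s)\<close>.\<close>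

lemma ambient_isotopic_inverse_graph:
  assumes "ambient_isotopic \<Gamma> \<Delta>"
  shows "ambient_isotopic (inverse_graph \<Gamma>) (inverse_graph \<Delta>)"
proof -
  have reverse: "\<exists>\<psi>. strict_mono_on {0..1} \<psi> \<and> continuous_on {0..1} \<psi> \<and> \<psi> ` {0..1} = {0..1} \<and>
      (\<forall>s\<in>{0..1}. reversepath p s = h (reversepath q (\<psi> s)))"
    if \<phi>: "strict_mono_on {0..1} \<phi>" "continuous_on {0..1} \<phi>" "\<phi> ` {0..1} = {0..1}"
      "\<forall>s\<in>{0..1}. p s = h (q (\<phi> s))"
    for \<phi> :: "real \<Rightarrow> real" and p q and h :: "real^3 \<Rightarrow> real^3"
  proof (intro exI conjI)
    let ?\<psi> = "\<lambda>s. 1 - \<phi> (1 - s)"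
    have flip: "(\<lambda>s::real. 1 - s) ` {0..1} = {0..1}" by simp
    show "strict_mono_on {0..1} ?\<psi>" using \<phi>(1) by (auto simp: strict_mono_on_def)
    show "continuous_on {0..1} ?\<psi>"
      by (intro continuous_intros continuous_on_compose2[OF \<phi>(2)]) auto
    have "?\<psi> ` {0..1} = (\<lambda>s. 1 - s) ` \<phi> ` (\<lambda>s. 1 - s) ` {0..1}"
      by (simp add: image_image del: image_diff_atLeastAtMost)
    then show "?\<psi> ` {0..1} = {0..1}" by (simp only: flip \<phi>(3))
    show "\<forall>s\<in>{0..1}. reversepath p s = h (reversepath q (?\<psi> s))"
      using \<phi>(4) by (simp add: reversepath_def)
  qed
  obtain h where
    h: "homotopic_with_canon (\<lambda>f :: real^3 \<Rightarrow> real^3. \<exists>g. homeomorphism UNIV UNIV f g) UNIV UNIV id h"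
    and graph: "graph \<Delta> = graph \<Gamma>"
    and point: "\<forall>v\<in>verts (graph \<Gamma>). point \<Delta> v = h (point \<Gamma> v)"
    and curve: "\<And>e. e \<in> arcs (graph \<Gamma>) \<Longrightarrow> \<exists>\<phi>. strict_mono_on {0..1} \<phi> \<and> continuous_on {0..1} \<phi> \<and>
      \<phi> ` {0..1} = {0..1} \<and> (\<forall>s\<in>{0..1}. curve \<Delta> e s = h (curve \<Gamma> e (\<phi> s)))"
    using assms unfolding ambient_isotopic_def by blast
  have "\<exists>\<psi>. strict_mono_on {0..1} \<psi> \<and> continuous_on {0..1} \<psi> \<and> \<psi> ` {0..1} = {0..1} \<and>
      (\<forall>s\<in>{0..1}. reversepath (curve \<Delta> e) s = h (reversepath (curve \<Gamma> e) (\<psi> s)))"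
    if e: "e \<in> arcs (graph \<Gamma>)" for e
  proof -
    obtain \<phi> where "strict_mono_on {0..1} \<phi>" "continuous_on {0..1} \<phi>" "\<phi> ` {0..1} = {0..1}"
      "\<forall>s\<in>{0..1}. curve \<Delta> e s = h (curve \<Gamma> e (\<phi> s))"
      using curve[OF e] by blast
    then show ?thesis by (rule reverse)
  qed
  then show ?thesis
    unfolding ambient_isotopic_def using h graph point
    by (intro conjI exI[of _ h]) (simp_all add: inverse_graph_def)
qed

section \<open>Diagrams with all edges reversed\<close>

lemma arcs_inverse_graph [simp]: "arcs (graph (inverse_graph \<Delta>)) = arcs (graph \<Delta>)"
  and verts_inverse_graph [simp]: "verts (graph (inverse_graph \<Delta>)) = verts (graph \<Delta>)"
  and point_inverse_graph [simp]: "point (inverse_graph \<Delta>) = point \<Delta>"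
  and curve_inverse_graph [simp]: "curve (inverse_graph \<Delta>) e = reversepath (curve \<Delta> e)"
  by (simp_all add: inverse_graph_def)

lemma inverse_graph_involution [simp]: "inverse_graph (inverse_graph \<Delta>) = \<Delta>"
  by (simp add: inverse_graph_def)

lemma shadow_inverse_graph: "shadow (inverse_graph \<Delta>) e = reversepath (shadow \<Delta> e)"
  by (simp add: shadow_def reversepath_def fun_eq_iff)

lemma support_inverse_graph: "support (inverse_graph \<Delta>) = support \<Delta>"
  by (simp add: support_def)

definition reverse_param :: "'e \<times> real \<Rightarrow> 'e \<times> real"
  where "reverse_param = (\<lambda>(e, s). (e, 1 - s))"

lemma fst_reverse_param [simp]: "fst (reverse_param p) = fst p"
  and reverse_param_involution [simp]: "reverse_param (reverse_param p) = p"
  and reverse_param_pair [simp]: "reverse_param (e, s) = (e, 1 - s)"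
  by (simp_all add: reverse_param_def split: prod.splits)

lemma crossings_inverse_graph_iff:
  "(p, q) \<in> crossings (inverse_graph \<Delta>) \<longleftrightarrow> (reverse_param p, reverse_param q) \<in> crossings \<Delta>"
  by (cases p; cases q) (auto simp: crossings_def shadow_inverse_graph reversepath_def)

lemma bij_betw_crossings_inverse_graph:
  "bij_betw (map_prod reverse_param reverse_param) (crossings \<Delta>) (crossings (inverse_graph \<Delta>))"
  by (rule bij_betw_byWitness[where f' = "map_prod reverse_param reverse_param"])
    (auto simp: crossings_inverse_graph_iff)

lemma undercrossings_inverse_graph:
  "undercrossings (inverse_graph \<Delta>) e = (\<lambda>u. 1 - u) ` undercrossings \<Delta> e"
proof -
  have under: "u \<in> undercrossings (inverse_graph \<Delta>) e \<longleftrightarrow> 1 - u \<in> undercrossings \<Delta> e" for u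
    unfolding undercrossings_def mem_Collect_eq crossings_inverse_graph_iff
    by (metis reverse_param_involution reverse_param_pair)
  have image: "u \<in> (\<lambda>u. 1 - u) ` U \<longleftrightarrow> 1 - u \<in> U" for u :: real and U
    using image_eqI[of u "\<lambda>u. 1 - u" "1 - u" U] by auto
  show ?thesis by (rule Set.set_eqI) (simp only: under image)
qed

lemma card_undercrossings_inverse_graph:
  "card (undercrossings (inverse_graph \<Delta>) e) = card (undercrossings \<Delta> e)"
  by (simp add: undercrossings_inverse_graph card_image inj_on_def)

lemma finite_undercrossings:
  assumes "finite (crossings \<Delta>)"
  shows "finite (undercrossings \<Delta> e)"
proof (rule finite_subset)
  show "undercrossings \<Delta> e \<subseteq> (\<lambda>c. snd (snd c)) ` crossings \<Delta>"
    by (force simp: undercrossings_def image_iff)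
qed (use assms in simp)

text \<open>An arc is numbered by the undercrossings before it; read backwards, these are the ones after it.\<close>

definition reverse_arc :: "('v, 'e) spatial \<Rightarrow> 'e diagram_arc \<Rightarrow> 'e diagram_arc"
  where "reverse_arc \<Delta> = (\<lambda>(e, i). (e, card (undercrossings \<Delta> e) - i))"

lemma bij_betw_reverse_arc:
  "bij_betw (reverse_arc \<Delta>) (diagram_arcs \<Delta>) (diagram_arcs (inverse_graph \<Delta>))"
  by (rule bij_betw_byWitness[where f' = "reverse_arc \<Delta>"])
    (auto simp: reverse_arc_def diagram_arcs_def card_undercrossings_inverse_graph)

lemma arc_before_in_diagram_arcs:
  "finite (crossings \<Delta>) \<Longrightarrow> fst p \<in> arcs (graph \<Delta>) \<Longrightarrow> arc_before \<Delta> p \<in> diagram_arcs \<Delta>"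
  and arc_after_in_diagram_arcs:
  "finite (crossings \<Delta>) \<Longrightarrow> fst p \<in> arcs (graph \<Delta>) \<Longrightarrow> arc_after \<Delta> p \<in> diagram_arcs \<Delta>"
  by (auto simp: arc_before_def arc_after_def diagram_arcs_def finite_undercrossings
      intro!: card_mono split: prod.splits)

lemma arc_before_inverse_graph:
  assumes "finite (crossings \<Delta>)"
  shows "arc_before (inverse_graph \<Delta>) (reverse_param p) = reverse_arc \<Delta> (arc_after \<Delta> p)"
proof -
  obtain e s where p: "p = (e, s)" by fastforce
  let ?U = "undercrossings \<Delta> e"
  have "{u \<in> undercrossings (inverse_graph \<Delta>) e. u < 1 - s} =
      (\<lambda>u. 1 - u) ` (?U - {u \<in> ?U. u \<le> s})"
    by (auto simp: undercrossings_inverse_graph)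
  then have "card {u \<in> undercrossings (inverse_graph \<Delta>) e. u < 1 - s} =
      card (?U - {u \<in> ?U. u \<le> s})"
    by (simp add: card_image inj_on_def)
  also have "\<dots> = card ?U - card {u \<in> ?U. u \<le> s}"
    using finite_undercrossings[OF assms] by (intro card_Diff_subset) auto
  finally show ?thesis
    by (simp add: p arc_before_def arc_after_def reverse_arc_def)
qed

lemma arc_after_inverse_graph:
  assumes "finite (crossings \<Delta>)"
  shows "arc_after (inverse_graph \<Delta>) (reverse_param p) = reverse_arc \<Delta> (arc_before \<Delta> p)"
proof -
  obtain e s where p: "p = (e, s)" by fastforce
  let ?U = "undercrossings \<Delta> e"
  have "{u \<in> undercrossings (inverse_graph \<Delta>) e. u \<le> 1 - s} =
      (\<lambda>u. 1 - u) ` (?U - {u \<in> ?U. u < s})"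
    by (auto simp: undercrossings_inverse_graph)
  then have "card {u \<in> undercrossings (inverse_graph \<Delta>) e. u \<le> 1 - s} =
      card (?U - {u \<in> ?U. u < s})"
    by (simp add: card_image inj_on_def)
  also have "\<dots> = card ?U - card {u \<in> ?U. u < s}"
    using finite_undercrossings[OF assms] by (intro card_Diff_subset) auto
  finally show ?thesis
    by (simp add: p arc_before_def arc_after_def reverse_arc_def)
qed

lemma regular_projectionD:
  assumes "regular_projection \<Delta>"
  shows "\<And>e. e \<in> arcs (graph \<Delta>) \<Longrightarrow> shadow \<Delta> e piecewise_C1_differentiable_on {0..1}"
    and "\<And>e. e \<in> arcs (graph \<Delta>) \<Longrightarrow> shadow \<Delta> e differentiable (at 0 within {0..1})"
    and "\<And>e. e \<in> arcs (graph \<Delta>) \<Longrightarrow> shadow \<Delta> e differentiable (at 1 within {0..1})"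
    and "finite (crossings \<Delta>)"
    and "\<And>x y z. x \<in> support \<Delta> \<Longrightarrow> y \<in> support \<Delta> \<Longrightarrow> z \<in> support \<Delta> \<Longrightarrow>
      plane x = plane y \<Longrightarrow> plane y = plane z \<Longrightarrow> x = y \<or> y = z \<or> x = z"
    and "\<And>v x. v \<in> verts (graph \<Delta>) \<Longrightarrow> x \<in> support \<Delta> \<Longrightarrow> plane x = plane (point \<Delta> v) \<Longrightarrow>
      x = point \<Delta> v"
    and "\<And>e s f u. ((e, s), (f, u)) \<in> crossings \<Delta> \<Longrightarrow> shadow \<Delta> e differentiable (at s)"
    and "\<And>e s f u. ((e, s), (f, u)) \<in> crossings \<Delta> \<Longrightarrow> shadow \<Delta> f differentiable (at u)"
    and "\<And>e s f u. ((e, s), (f, u)) \<in> crossings \<Delta> \<Longrightarrow> crossing_cross \<Delta> ((e, s), (f, u)) \<noteq> 0"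
    and "\<And>v x. v \<in> verts (graph \<Delta>) \<Longrightarrow> x \<in> vertex_ends (graph \<Delta>) v \<Longrightarrow> end_direction \<Delta> x \<noteq> 0"
    and "\<And>v. v \<in> verts (graph \<Delta>) \<Longrightarrow>
      inj_on (\<lambda>x. sgn (end_direction \<Delta> x)) (vertex_ends (graph \<Delta>) v)"
  using assms unfolding regular_projection_def by - (elim conjE; blast)+

lemma curve_in_support:
  "e \<in> arcs (graph \<Delta>) \<Longrightarrow> s \<in> {0<..<1} \<Longrightarrow> curve \<Delta> e s \<in> support \<Delta>"
  by (auto simp: support_def path_image_def intro!: bexI[of _ e])

text \<open>Otherwise three points of the graph at different heights would lie over the same point of the
  plane.\<close>

lemma overpass_not_undercrossing:
  assumes "regular_projection \<Delta>" and c: "((e, s), (f, u)) \<in> crossings \<Delta>"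
  shows "s \<notin> undercrossings \<Delta> e"
proof
  assume "s \<in> undercrossings \<Delta> e"
  then obtain g r where d: "((g, r), (e, s)) \<in> crossings \<Delta>"
    by (auto simp: undercrossings_def)
  let ?x = "curve \<Delta> g r" and ?y = "curve \<Delta> e s" and ?z = "curve \<Delta> f u"
  have "?x \<in> support \<Delta>" "?y \<in> support \<Delta>" "?z \<in> support \<Delta>"
    using c d by (auto simp: crossings_def intro!: curve_in_support)
  moreover have "plane ?x = plane ?y" "plane ?y = plane ?z"
    and heights: "height ?z < height ?y" "height ?y < height ?x"
    using c d by (auto simp: crossings_def shadow_def)
  ultimately have "?x = ?y \<or> ?y = ?z \<or> ?x = ?z"
    using regular_projectionD(5)[OF assms(1)] by blast
  then show False using heights by auto
qed

text \<open>This is what makes the overarc of a crossing independent of the direction in which the overpass is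
  traversed.\<close>

lemma arc_after_overpass:
  assumes "regular_projection \<Delta>" and "(p, q) \<in> crossings \<Delta>"
  shows "arc_after \<Delta> p = arc_before \<Delta> p"
proof -
  obtain e s where p: "p = (e, s)" by fastforce
  have "s \<notin> undercrossings \<Delta> e"
    using overpass_not_undercrossing[OF assms(1)] assms(2) p by (metis surj_pair)
  then have "{u \<in> undercrossings \<Delta> e. u \<le> s} = {u \<in> undercrossings \<Delta> e. u < s}"
    by (auto simp: order_le_less)
  then show ?thesis by (simp add: p arc_after_def arc_before_def)
qed

lemma has_vector_derivative_reversepath:
  assumes "(f has_vector_derivative f') (at s within S)" and "(\<lambda>x. 1 - x) ` S = S"
  shows "(reversepath f has_vector_derivative - f') (at (1 - s) within S)"
proof -
  have "((\<lambda>x. 1 - x) has_vector_derivative - 1) (at (1 - s) within S)"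
    by (auto intro!: derivative_eq_intros)
  from vector_diff_chain_within[OF this] show ?thesis
    using assms by (simp add: reversepath_def o_def)
qed

lemma reversepath_derivative:
  assumes "f differentiable (at s within S)" and "(\<lambda>x. 1 - x) ` S = S"
    and "at (1 - s) within S \<noteq> bot"
  shows "reversepath f differentiable (at (1 - s) within S)"
    and "vector_derivative (reversepath f) (at (1 - s) within S) =
      - vector_derivative f (at s within S)"
proof -
  have "(reversepath f has_vector_derivative - vector_derivative f (at s within S))
      (at (1 - s) within S)"
    using assms(1,2) by (intro has_vector_derivative_reversepath) (simp add: vector_derivative_works)
  then show "reversepath f differentiable (at (1 - s) within S)"
    and "vector_derivative (reversepath f) (at (1 - s) within S) =
      - vector_derivative f (at s within S)"
    using assms(3) by (auto simp: differentiableI_vector intro: vector_derivative_within)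
qed

lemma reflect_UNIV: "(\<lambda>x::real. 1 - x) ` UNIV = UNIV"
  by (rule surjI[of _ "\<lambda>x. 1 - x"]) simp

lemma reversepath_derivative_at:
  assumes "f differentiable (at s)"
  shows "reversepath f differentiable (at (1 - s))"
    and "vector_derivative (reversepath f) (at (1 - s)) = - vector_derivative f (at s)"
  using reversepath_derivative[OF assms reflect_UNIV] by simp_all

lemma reversepath_derivative_ends:
  fixes f :: "real \<Rightarrow> 'a::real_normed_vector"
  assumes "f differentiable (at s within {0..1})" and "s \<in> {0, 1}"
  shows "reversepath f differentiable (at (1 - s) within {0..1})"
    and "vector_derivative (reversepath f) (at (1 - s) within {0..1}) =
      - vector_derivative f (at s within {0..1})"
proof -
  have reflect: "(\<lambda>x::real. 1 - x) ` {0..1} = {0..1}" by simp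
  have nontrivial: "at (1 - s) within {0..1} \<noteq> bot"
    using assms(2) by (auto simp: trivial_limit_within islimpt_Icc)
  from reversepath_derivative[OF assms(1) reflect nontrivial]
  show "reversepath f differentiable (at (1 - s) within {0..1})"
    and "vector_derivative (reversepath f) (at (1 - s) within {0..1}) =
      - vector_derivative f (at s within {0..1})" .
qed

text \<open>Both velocities are negated.  The sign of the crossing is thus unchanged, while the arcs before and
  after the underpass are exchanged.\<close>

lemma crossing_cross_inverse_graph:
  assumes "regular_projection \<Delta>" and "c \<in> crossings \<Delta>"
  shows "crossing_cross (inverse_graph \<Delta>) (map_prod reverse_param reverse_param c) =
    crossing_cross \<Delta> c"
proof -
  obtain e s f u where c: "c = ((e, s), (f, u))" by (metis surj_pair)
  show ?thesis
    using regular_projectionD(7,8)[OF assms(1), of e s f u] assms(2)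
    by (simp add: c crossing_cross_def velocity_def shadow_inverse_graph reversepath_derivative_at)
qed

definition reverse_end :: "'e arc_end \<Rightarrow> 'e arc_end"
  where "reverse_end = (\<lambda>(e, \<epsilon>). (e, - \<epsilon>))"

lemma vertex_ends_inverse_graph:
  "vertex_ends (graph (inverse_graph \<Delta>)) v = reverse_end ` vertex_ends (graph \<Delta>) v"
  by (force simp: vertex_ends_def reverse_end_def inverse_graph_def in_arcs_def out_arcs_def image_iff)

text \<open>The direction in which an end leaves its vertex is a property of the unoriented edge, so reversal
  preserves the clockwise order.\<close>

lemma end_direction_inverse_graph:
  assumes "regular_projection \<Delta>" and "x \<in> vertex_ends (graph \<Delta>) v"
  shows "end_direction (inverse_graph \<Delta>) (reverse_end x) = end_direction \<Delta> x"
proof -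
  have "fst x \<in> arcs (graph \<Delta>)" "snd x \<in> {1, -1}"
    using assms(2) by (auto simp: vertex_ends_def in_arcs_def out_arcs_def)
  then show ?thesis
    using reversepath_derivative_ends(2)[of "shadow \<Delta> (fst x)" 0]
      reversepath_derivative_ends(2)[of "shadow \<Delta> (fst x)" 1]
      regular_projectionD(2,3)[OF assms(1)]
    by (auto simp: end_direction_def reverse_end_def shadow_inverse_graph split: prod.splits)
qed

lemma regular_projection_inverse_graph:
  assumes "regular_projection \<Delta>"
  shows "regular_projection (inverse_graph \<Delta>)"
proof -
  note reg = regular_projectionD[OF assms]
  have crossing: "shadow (inverse_graph \<Delta>) e differentiable (at s) \<and>
      shadow (inverse_graph \<Delta>) f differentiable (at u) \<and>
      crossing_cross (inverse_graph \<Delta>) ((e, s), (f, u)) \<noteq> 0"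
    if "((e, s), (f, u)) \<in> crossings (inverse_graph \<Delta>)" for e s f u
  proof -
    have c: "((e, 1 - s), (f, 1 - u)) \<in> crossings \<Delta>"
      using that by (simp add: crossings_inverse_graph_iff)
    show ?thesis
      using reversepath_derivative_at(1)[OF reg(7)[OF c]] reversepath_derivative_at(1)[OF reg(8)[OF c]]
        crossing_cross_inverse_graph[OF assms c] reg(9)[OF c]
      by (simp add: shadow_inverse_graph)
  qed
  have inj: "inj_on (\<lambda>x. sgn (end_direction (inverse_graph \<Delta>) x))
      (vertex_ends (graph (inverse_graph \<Delta>)) v)" if "v \<in> verts (graph \<Delta>)" for v
    unfolding vertex_ends_inverse_graph
    by (rule inj_on_imageI)
      (use reg(11)[OF that] in \<open>simp add: inj_on_def o_def end_direction_inverse_graph[OF assms]\<close>)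
  show ?thesis
    unfolding regular_projection_def
  proof (intro conjI ballI)
    fix e assume e: "e \<in> arcs (graph (inverse_graph \<Delta>))"
    show "shadow (inverse_graph \<Delta>) e piecewise_C1_differentiable_on {0..1}"
      using e reg(1)[of e] valid_path_reversepath[of "shadow \<Delta> e"]
      by (simp add: valid_path_def shadow_inverse_graph)
    show "shadow (inverse_graph \<Delta>) e differentiable (at 0 within {0..1})"
      "shadow (inverse_graph \<Delta>) e differentiable (at 1 within {0..1})"
      using e reg(2,3)[of e] reversepath_derivative_ends(1)[of "shadow \<Delta> e" 1]
        reversepath_derivative_ends(1)[of "shadow \<Delta> e" 0]
      by (simp_all add: shadow_inverse_graph)
  next
    show "finite (crossings (inverse_graph \<Delta>))"
      using bij_betw_finite[OF bij_betw_crossings_inverse_graph] reg(4) by blast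
  next
    fix c assume "c \<in> crossings (inverse_graph \<Delta>)"
    then show "(\<lambda>((e, s), (f, u)). shadow (inverse_graph \<Delta>) e differentiable (at s) \<and>
        shadow (inverse_graph \<Delta>) f differentiable (at u) \<and>
        crossing_cross (inverse_graph \<Delta>) ((e, s), (f, u)) \<noteq> 0) c"
      using crossing by (auto split: prod.splits)
  next
    fix v x assume "v \<in> verts (graph (inverse_graph \<Delta>))"
      and "x \<in> vertex_ends (graph (inverse_graph \<Delta>)) v"
    then show "end_direction (inverse_graph \<Delta>) x \<noteq> 0"
      using reg(10) by (auto simp: vertex_ends_inverse_graph end_direction_inverse_graph[OF assms])
  next
    fix v assume "v \<in> verts (graph (inverse_graph \<Delta>))"
    then show "inj_on (\<lambda>x. sgn (end_direction (inverse_graph \<Delta>) x))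
        (vertex_ends (graph (inverse_graph \<Delta>)) v)"
      using inj by simp
  qed (use reg(5,6) in \<open>auto simp: support_inverse_graph\<close>)
qed

lemma alexander_matrix_inverse_graph:
  assumes reg: "regular_projection \<Delta>" and M: "alexander_matrix \<Delta> \<omega> M"
  obtains M' where "alexander_matrix (inverse_graph \<Delta>) \<omega> M'" and "unit_scaled_inversion M M'"
proof -
  let ?\<kappa> = "map_prod reverse_param reverse_param"
  have fin: "finite (crossings \<Delta>)" using regular_projectionD(4)[OF reg] .
  note inj = bij_betw_imp_inj_on[OF bij_betw_reverse_arc[of \<Delta>]]
  show thesis
  proof (rule alexander_matrix_transport[OF bij_betw_crossings_inverse_graph bij_betw_reverse_arc
        verts_inverse_graph _ _ _ _ M, where f = "map reverse_end" and \<delta> = "of_int (- 1)"])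
    fix c x assume c: "c \<in> crossings \<Delta>" and x: "x \<in> diagram_arcs \<Delta>"
    obtain p q where pq: "c = (p, q)" by (rule prod.exhaust)
    have arcs: "fst p \<in> arcs (graph \<Delta>)" "fst q \<in> arcs (graph \<Delta>)"
      using c pq by (auto simp: crossings_def)
    note cross = crossing_cross_inverse_graph[OF reg c]
    show "crossing_coeff (inverse_graph \<Delta>) \<omega> (?\<kappa> c) (reverse_arc \<Delta> x) =
        - t_pow (\<omega> (fst (fst c)) + \<omega> (fst (snd c))) * t_pow (- \<omega> (fst x)) *
          invert_t (crossing_coeff \<Delta> \<omega> c x)"
    proof (rule crossing_coeff_swap_sides[OF inj x])
      show "overarc \<Delta> c \<in> diagram_arcs \<Delta>" "left_underarc \<Delta> c \<in> diagram_arcs \<Delta>"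
        "right_underarc \<Delta> c \<in> diagram_arcs \<Delta>"
        using arcs by (simp_all add: pq overarc_def left_underarc_def right_underarc_def
            arc_before_in_diagram_arcs[OF fin] arc_after_in_diagram_arcs[OF fin])
      show "overarc (inverse_graph \<Delta>) (?\<kappa> c) = reverse_arc \<Delta> (overarc \<Delta> c)"
        using arc_after_overpass[OF reg] c
        by (simp add: pq overarc_def arc_before_inverse_graph[OF fin])
      show "left_underarc (inverse_graph \<Delta>) (?\<kappa> c) = reverse_arc \<Delta> (right_underarc \<Delta> c)"
        "right_underarc (inverse_graph \<Delta>) (?\<kappa> c) = reverse_arc \<Delta> (left_underarc \<Delta> c)"
        using cross by (simp_all add: pq left_underarc_def right_underarc_def
            arc_before_inverse_graph[OF fin] arc_after_inverse_graph[OF fin])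
    qed (simp_all add: pq)
  next
    fix v xs assume v: "v \<in> verts (graph \<Delta>)" and xs: "clockwise_ends \<Delta> v xs"
    then have set: "set xs = vertex_ends (graph \<Delta>) v" by (simp add: clockwise_ends_def)
    show "clockwise_ends (inverse_graph \<Delta>) v (map reverse_end xs)"
    proof (cases "xs = []")
      case True
      then show ?thesis using set by (simp add: clockwise_ends_def vertex_ends_inverse_graph)
    next
      case False
      have direction: "end_direction (inverse_graph \<Delta>) (reverse_end y) = end_direction \<Delta> y"
        if "y \<in> set xs" for y
        using end_direction_inverse_graph[OF reg, of y v] that set by simp
      have "map (\<lambda>y. Arg2pi (end_direction (inverse_graph \<Delta>) (hd (map reverse_end xs)) /
            end_direction (inverse_graph \<Delta>) y)) (map reverse_end xs) =
          map (\<lambda>y. Arg2pi (end_direction \<Delta> (hd xs) / end_direction \<Delta> y)) xs"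
        using False by (simp add: hd_map direction)
      then show ?thesis using xs
        by (simp only: clockwise_ends_def vertex_ends_inverse_graph set_map) 
    qed
    fix x assume x: "x \<in> diagram_arcs \<Delta>"
    have ends: "fst y \<in> arcs (graph \<Delta>)" "snd y \<in> {1, -1}" if "y \<in> set xs" for y
      using that unfolding set by (auto simp: vertex_ends_def in_arcs_def out_arcs_def)
    show "vertex_coeff (inverse_graph \<Delta>) \<omega> (map reverse_end xs) (reverse_arc \<Delta> x) =
        of_int (- 1) * t_pow (- \<omega> (fst x)) * invert_t (vertex_coeff \<Delta> \<omega> xs x)"
    proof (rule vertex_coeff_invert_exponents[OF inj x, where \<pi> = id])
      show "arc_of_end \<Delta> y \<in> diagram_arcs \<Delta>" if "y \<in> set xs" for y
        using ends(1)[OF that] by (auto simp: arc_of_end_def split: prod.splits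
            intro!: arc_before_in_diagram_arcs[OF fin] arc_after_in_diagram_arcs[OF fin])
      fix i assume i: "i < length xs"
      obtain e \<epsilon> where y: "xs ! i = (e, \<epsilon>)" by fastforce
      have \<epsilon>: "\<epsilon> = 1 \<or> \<epsilon> = -1" using ends(2)[OF nth_mem[OF i]] y by simp
      show "arc_of_end (inverse_graph \<Delta>) (map reverse_end xs ! id i) =
          reverse_arc \<Delta> (arc_of_end \<Delta> (xs ! i))"
        using \<epsilon> arc_before_inverse_graph[OF fin, of "(e, 0)"] arc_after_inverse_graph[OF fin, of "(e, 1)"]
        by (auto simp: i y reverse_end_def arc_of_end_def)
      show "snd (map reverse_end xs ! id i) = - 1 * snd (xs ! i)"
        by (simp add: i y reverse_end_def)
      have "(\<Sum>j<i. snd (map reverse_end xs ! j) * \<omega> (fst (map reverse_end xs ! j))) =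
          - (\<Sum>j<i. snd (xs ! j) * \<omega> (fst (xs ! j)))"
        unfolding sum_negf[symmetric] using i
        by (intro sum.cong) (auto simp: reverse_end_def split: prod.splits)
      then show "end_exponent \<omega> (map reverse_end xs) (id i) =
          - end_exponent \<omega> xs i - \<omega> (fst (xs ! i))"
        using \<epsilon> i by (auto simp: end_exponent_def y reverse_end_def)
    qed simp_all
  qed (use that in simp_all)
qed

lemma alexander_polynomial_inverse_graph:
  assumes "p \<in> alexander_polynomial \<Gamma> \<omega> k"
  shows "invert_t p \<in> alexander_polynomial (inverse_graph \<Gamma>) \<omega> k"
proof -
  obtain \<Delta> M where "ambient_isotopic \<Gamma> \<Delta>" and reg: "regular_projection \<Delta>"
    and M: "alexander_matrix \<Delta> \<omega> M" and gcd: "is_minor_gcd M (int (dim_row M) - int k) p"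
    using assms by (auto simp: alexander_polynomial_def)
  obtain M' where "alexander_matrix (inverse_graph \<Delta>) \<omega> M'" and M': "unit_scaled_inversion M M'"
    using alexander_matrix_inverse_graph[OF reg M] .
  moreover have "dim_row M' = dim_row M" using M' by (simp add: unit_scaled_inversion_def)
  ultimately show ?thesis
    unfolding alexander_polynomial_def mem_Collect_eq
    using ambient_isotopic_inverse_graph[OF \<open>ambient_isotopic \<Gamma> \<Delta>\<close>]
      regular_projection_inverse_graph[OF reg] is_minor_gcd_unit_scaled_inversion[OF M' gcd]
    by (intro exI[of _ "inverse_graph \<Delta>"] exI[of _ M']) simp
qed

section \<open>Reflected diagrams\<close>

text \<open>The reflection that acts on the plane of projection as complex conjugation and preserves heights.\<close>

definition mirror :: "real^3 \<Rightarrow> real^3"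
  where "mirror = reflection 0 (axis 2 1)"

lemma plane_reflection_mirror: "plane_reflection mirror"
  unfolding plane_reflection_iff
  by (rule exI[of _ 0], rule exI[of _ "axis 2 1"]) (simp add: mirror_def)

lemma mirror_eq: "mirror x = x - (2 * vec_nth x 2) *\<^sub>R axis 2 1"
  by (simp add: mirror_def reflection_def inner_axis inner_axis_axis)

lemma plane_mirror [simp]: "plane (mirror x) = cnj (plane x)"
  and height_mirror [simp]: "height (mirror x) = height x"
  by (simp_all add: mirror_eq plane_def height_def axis_def complex_eq_iff)

lemma mirror_mirror [simp]: "mirror (mirror x) = x"
  unfolding mirror_def by (rule reflection_involution) simp

lemma image_graph_simps [simp]:
  "graph (image_graph \<rho> \<Delta>) = graph \<Delta>"
  "point (image_graph \<rho> \<Delta>) v = \<rho> (point \<Delta> v)"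
  "curve (image_graph \<rho> \<Delta>) e = \<rho> \<circ> curve \<Delta> e"
  by (simp_all add: image_graph_def fun_eq_iff)

lemma shadow_mirror: "shadow (image_graph mirror \<Delta>) e = cnj \<circ> shadow \<Delta> e"
  by (simp add: shadow_def fun_eq_iff)

lemma support_image_graph: "support (image_graph \<rho> \<Delta>) = \<rho> ` support \<Delta>"
  by (simp add: support_def path_image_def image_Un image_UN image_comp o_def)

lemma crossings_mirror: "crossings (image_graph mirror \<Delta>) = crossings \<Delta>"
  by (simp add: crossings_def shadow_mirror)

lemma undercrossings_mirror: "undercrossings (image_graph mirror \<Delta>) = undercrossings \<Delta>"
  by (simp add: undercrossings_def crossings_mirror fun_eq_iff)

lemma arcs_mirror:
  "diagram_arcs (image_graph mirror \<Delta>) = diagram_arcs \<Delta>"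
  "arc_before (image_graph mirror \<Delta>) = arc_before \<Delta>"
  "arc_after (image_graph mirror \<Delta>) = arc_after \<Delta>"
  "arc_of_end (image_graph mirror \<Delta>) = arc_of_end \<Delta>"
  by (simp_all add: diagram_arcs_def arc_before_def arc_after_def arc_of_end_def
      undercrossings_mirror cong: if_cong)

lemma cnj_derivative:
  assumes "f differentiable (at s within S)" and "at s within S \<noteq> bot"
  shows "cnj \<circ> f differentiable (at s within S)"
    and "vector_derivative (cnj \<circ> f) (at s within S) = cnj (vector_derivative f (at s within S))"
proof -
  have "((cnj \<circ> f) has_vector_derivative cnj (vector_derivative f (at s within S))) (at s within S)"
    unfolding o_def using assms(1)
    by (intro bounded_linear.has_vector_derivative[OF bounded_linear_cnj])
      (simp add: vector_derivative_works)
  then show "cnj \<circ> f differentiable (at s within S)"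
    and "vector_derivative (cnj \<circ> f) (at s within S) = cnj (vector_derivative f (at s within S))"
    using assms(2) by (auto simp: differentiableI_vector intro: vector_derivative_within)
qed

lemma unit_interval_end_nontrivial: "s \<in> {0, 1} \<Longrightarrow> at s within {0..1::real} \<noteq> bot"
  by (auto simp: trivial_limit_within islimpt_Icc)

lemma crossing_cross_mirror:
  assumes "regular_projection \<Delta>" and "c \<in> crossings \<Delta>"
  shows "crossing_cross (image_graph mirror \<Delta>) c = - crossing_cross \<Delta> c"
proof -
  obtain e s f u where c: "c = ((e, s), (f, u))" by (metis surj_pair)
  show ?thesis
    using regular_projectionD(7,8)[OF assms(1), of e s f u] assms(2)
    by (simp add: c crossing_cross_def velocity_def shadow_mirror cnj_derivative)
qed

lemma end_direction_mirror:
  assumes "regular_projection \<Delta>" and "x \<in> vertex_ends (graph \<Delta>) v"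
  shows "end_direction (image_graph mirror \<Delta>) x = cnj (end_direction \<Delta> x)"
proof -
  have "fst x \<in> arcs (graph \<Delta>)"
    using assms(2) by (auto simp: vertex_ends_def in_arcs_def out_arcs_def)
  then show ?thesis
    using regular_projectionD(2,3)[OF assms(1)]
    by (auto simp: end_direction_def shadow_mirror cnj_derivative unit_interval_end_nontrivial
        split: prod.splits)
qed

lemma sgn_cnj: "sgn (cnj z) = cnj (sgn z)"
  by (simp add: sgn_div_norm)

lemma regular_projection_mirror:
  assumes "regular_projection \<Delta>"
  shows "regular_projection (image_graph mirror \<Delta>)"
proof -
  note reg = regular_projectionD[OF assms]
  let ?\<Delta> = "image_graph mirror \<Delta>"
  show ?thesis
    unfolding regular_projection_def
  proof (intro conjI ballI)
    fix e assume e: "e \<in> arcs (graph ?\<Delta>)"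
    show "shadow ?\<Delta> e piecewise_C1_differentiable_on {0..1}"
      using e reg(1)[of e] valid_path_cnj[of "shadow \<Delta> e"]
      by (simp add: valid_path_def shadow_mirror)
    show "shadow ?\<Delta> e differentiable (at 0 within {0..1})"
      "shadow ?\<Delta> e differentiable (at 1 within {0..1})"
      using e reg(2,3)[of e]
      by (simp_all add: shadow_mirror cnj_derivative unit_interval_end_nontrivial)
  next
    show "finite (crossings ?\<Delta>)" using reg(4) by (simp add: crossings_mirror)
  next
    fix c assume c: "c \<in> crossings ?\<Delta>"
    then show "(\<lambda>((e, s), (f, u)). shadow ?\<Delta> e differentiable (at s) \<and>
        shadow ?\<Delta> f differentiable (at u) \<and> crossing_cross ?\<Delta> ((e, s), (f, u)) \<noteq> 0) c"
      using reg(7-9) crossing_cross_mirror[OF assms]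
      by (auto simp: crossings_mirror shadow_mirror cnj_derivative split: prod.splits)
  next
    fix v x assume "v \<in> verts (graph ?\<Delta>)" and "x \<in> vertex_ends (graph ?\<Delta>) v"
    then show "end_direction ?\<Delta> x \<noteq> 0"
      using reg(10) by (simp add: end_direction_mirror[OF assms])
  next
    fix v assume "v \<in> verts (graph ?\<Delta>)"
    then show "inj_on (\<lambda>x. sgn (end_direction ?\<Delta> x)) (vertex_ends (graph ?\<Delta>) v)"
      using reg(11)[of v]
      by (simp add: inj_on_def end_direction_mirror[OF assms] sgn_cnj)
  next
    fix x y z assume "x \<in> support ?\<Delta>" "y \<in> support ?\<Delta>" "z \<in> support ?\<Delta>"
    then show "plane x = plane y \<and> plane y = plane z \<longrightarrow> x = y \<or> y = z \<or> x = z"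
      using reg(5) by (auto simp: support_image_graph) (metis mirror_mirror)
  next
    fix v x assume "v \<in> verts (graph ?\<Delta>)" "x \<in> support ?\<Delta>"
    then show "plane x = plane (point ?\<Delta> v) \<longrightarrow> x = point ?\<Delta> v"
      by (auto simp: support_image_graph intro!: arg_cong[of _ _ mirror] intro: reg(6))
  qed
qed

lemma clockwise_ends_distinct: "clockwise_ends \<Delta> v xs \<Longrightarrow> distinct xs"
  unfolding clockwise_ends_def
  by (auto simp: strict_sorted_iff distinct_map)

text \<open>Balance in terms of the ends at a vertex; a loop contributes its weight with both signs.\<close>

lemma sum_ends_eq_0:
  assumes "balanced (graph \<Delta>) \<omega>" and v: "v \<in> verts (graph \<Delta>)" and xs: "clockwise_ends \<Delta> v xs"
  shows "(\<Sum>i<length xs. snd (xs ! i) * \<omega> (fst (xs ! i))) = 0"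
proof -
  let ?I = "in_arcs (graph \<Delta>) v" and ?O = "out_arcs (graph \<Delta>) v"
  have set: "set xs = ?I \<times> {1} \<union> ?O \<times> {-1}"
    using xs by (simp add: clockwise_ends_def vertex_ends_def)
  have fin: "finite (?I \<times> {1::int} \<union> ?O \<times> {-1})" unfolding set[symmetric] by simp
  have "(\<Sum>i<length xs. snd (xs ! i) * \<omega> (fst (xs ! i))) =
      sum_list (map (\<lambda>y. snd y * \<omega> (fst y)) xs)"
    by (simp add: sum_list_sum_nth atLeast0LessThan)
  also have "\<dots> = (\<Sum>y\<in>?I \<times> {1} \<union> ?O \<times> {-1}. snd y * \<omega> (fst y))"
    using clockwise_ends_distinct[OF xs] set by (simp add: sum_list_distinct_conv_sum_set)
  also have "\<dots> = (\<Sum>y\<in>?I \<times> {1}. snd y * \<omega> (fst y)) + (\<Sum>y\<in>?O \<times> {-1}. snd y * \<omega> (fst y))"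
    using fin by (intro sum.union_disjoint) auto
  also have "\<dots> = (\<Sum>e\<in>?I. \<omega> e) - (\<Sum>e\<in>?O. \<omega> e)"
    unfolding sum.cartesian_product' by (simp add: sum_negf)
  also have "\<dots> = 0" using assms(1) v by (simp add: balanced_def)
  finally show ?thesis .
qed

lemma Arg2pi_cnj_divide:
  assumes "h \<noteq> 0" "l \<noteq> 0" "z \<noteq> 0" and "Arg2pi (h / z) \<le> Arg2pi (h / l)"
  shows "Arg2pi (cnj (l / z)) = Arg2pi (h / l) - Arg2pi (h / z)"
proof -
  have "Arg2pi (cnj (l / z)) = Arg2pi (inverse (l / z))"
    using assms by (intro Arg2pi_cnj_eq_inverse) simp
  also have "inverse (l / z) = (h / l) / (h / z)" using assms by (simp add: field_simps)
  also have "Arg2pi \<dots> = Arg2pi (h / l) - Arg2pi (h / z)"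
    using assms by (intro Arg2pi_divide) auto
  finally show ?thesis .
qed

text \<open>With \<open>\<theta>\<close> the clockwise angle from the first end, the reflected angle from the last end to \<open>x\<close> is
  \<open>\<theta>(last) - \<theta>(x)\<close>, which increases along the reversed list.\<close>

lemma clockwise_ends_mirror:
  assumes reg: "regular_projection \<Delta>" and v: "v \<in> verts (graph \<Delta>)" and xs: "clockwise_ends \<Delta> v xs"
  shows "clockwise_ends (image_graph mirror \<Delta>) v (rev xs)"
proof (cases "xs = []")
  case True
  then show ?thesis using xs by (simp add: clockwise_ends_def)
next
  case False
  define d where "d = end_direction \<Delta>"
  define \<theta> where "\<theta> x = Arg2pi (d (hd xs) / d x)" for x
  have set: "set xs = vertex_ends (graph \<Delta>) v" and sorted: "sorted_wrt (\<lambda>x y. \<theta> x < \<theta> y) xs"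
    using xs by (simp_all add: clockwise_ends_def sorted_wrt_map \<theta>_def d_def)
  have nz: "d x \<noteq> 0" if "x \<in> set xs" for x
    using regular_projectionD(10)[OF reg v] that set by (simp add: d_def)
  have last: "\<theta> x \<le> \<theta> (last xs)" if "x \<in> set xs" for x
  proof -
    have "sorted_wrt (\<lambda>x y. \<theta> x < \<theta> y) (butlast xs @ [last xs])" using sorted False by simp
    moreover have "x \<in> set (butlast xs) \<or> x = last xs"
      using that False by (metis append_butlast_last_id in_set_conv_decomp rotate1.simps(2) set_ConsD set_rotate1)
    ultimately show ?thesis unfolding sorted_wrt_append by auto
  qed
  have "Arg2pi (cnj (d (last xs)) / cnj (d x)) = \<theta> (last xs) - \<theta> x" if "x \<in> set xs" for x
    using Arg2pi_cnj_divide[of "d (hd xs)" "d (last xs)" "d x"] nz last that False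
    by (simp add: \<theta>_def)
  moreover have "end_direction (image_graph mirror \<Delta>) x = cnj (d x)" if "x \<in> set xs" for x
    using end_direction_mirror[OF reg, of x v] that set by (simp add: d_def)
  ultimately have angle: "Arg2pi (end_direction (image_graph mirror \<Delta>) (last xs) /
      end_direction (image_graph mirror \<Delta>) x) = \<theta> (last xs) - \<theta> x" if "x \<in> set xs" for x
    using that False by simp
  have "sorted_wrt (\<lambda>y x.
      Arg2pi (end_direction (image_graph mirror \<Delta>) (last xs) / end_direction (image_graph mirror \<Delta>) x) <
      Arg2pi (end_direction (image_graph mirror \<Delta>) (last xs) / end_direction (image_graph mirror \<Delta>) y)) xs"
    by (rule sorted_wrt_mono_rel[OF _ sorted]) (simp add: angle)
  then show ?thesis
    using set False by (simp add: clockwise_ends_def sorted_wrt_map sorted_wrt_rev hd_rev)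
qed

text \<open>The ends before the \<open>i\<close>th one in the reversed list are those after it in the original list, and by
  balance their total is minus the total of the ends up to and including the \<open>i\<close>th one.  The
  \<open>i\<close>th end itself gives the additional weight, because \<open>2 min(\<epsilon>, 0) - \<epsilon> = -1\<close> for both signs.\<close>

lemma end_exponent_rev:
  assumes "(\<Sum>j<length xs. snd (xs ! j) * \<omega> (fst (xs ! j))) = 0"
    and i: "i < length xs" and "snd (xs ! i) = 1 \<or> snd (xs ! i) = -1"
  shows "end_exponent \<omega> (rev xs) (length xs - Suc i) = - end_exponent \<omega> xs i - \<omega> (fst (xs ! i))"
proof -
  let ?g = "\<lambda>j. snd (xs ! j) * \<omega> (fst (xs ! j))"
  have "(\<Sum>j<length xs - Suc i. snd (rev xs ! j) * \<omega> (fst (rev xs ! j))) =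
      (\<Sum>j\<in>{Suc i..<length xs}. ?g j)"
    by (rule sum.reindex_bij_witness[where i = "\<lambda>j. length xs - Suc j" and j = "\<lambda>j. length xs - Suc j"])
      (use i in \<open>auto simp: rev_nth\<close>)
  moreover have "sum ?g {..<length xs} = sum ?g {..<Suc i} + sum ?g {Suc i..<length xs}"
    using i sum.atLeastLessThan_concat[of 0 "Suc i" "length xs" ?g] by (simp add: atLeast0LessThan)
  ultimately show ?thesis
    using assms by (auto simp: end_exponent_def rev_nth)
qed

lemma alexander_matrix_mirror:
  assumes reg: "regular_projection \<Delta>" and bal: "balanced (graph \<Delta>) \<omega>"
    and M: "alexander_matrix \<Delta> \<omega> M"
  obtains M' where "alexander_matrix (image_graph mirror \<Delta>) \<omega> M'"
    and "unit_scaled_inversion M M'"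
proof -
  let ?\<Delta> = "image_graph mirror \<Delta>"
  have fin: "finite (crossings \<Delta>)" using regular_projectionD(4)[OF reg] .
  have crossings: "bij_betw id (crossings \<Delta>) (crossings ?\<Delta>)"
    and arcs: "bij_betw id (diagram_arcs \<Delta>) (diagram_arcs ?\<Delta>)"
    by (simp_all add: crossings_mirror arcs_mirror)
  have verts: "verts (graph ?\<Delta>) = verts (graph \<Delta>)" by simp
  show thesis
  proof (rule alexander_matrix_transport[OF crossings arcs verts _ _ _ _ M,
        where f = rev and \<delta> = "of_int 1"])
    fix c x assume c: "c \<in> crossings \<Delta>" and x: "x \<in> diagram_arcs \<Delta>"
    obtain p q where pq: "c = (p, q)" by (rule prod.exhaust)
    have arcs: "fst p \<in> arcs (graph \<Delta>)" "fst q \<in> arcs (graph \<Delta>)"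
      using c pq by (auto simp: crossings_def)
    have cross: "crossing_cross \<Delta> c \<noteq> 0"
      using regular_projectionD(9)[OF reg] c by (metis surj_pair)
    show "crossing_coeff ?\<Delta> \<omega> (id c) (id x) =
        - t_pow (\<omega> (fst (fst c)) + \<omega> (fst (snd c))) * t_pow (- \<omega> (fst x)) *
          invert_t (crossing_coeff \<Delta> \<omega> c x)"
    proof (rule crossing_coeff_swap_sides[OF inj_on_id x])
      show "overarc \<Delta> c \<in> diagram_arcs \<Delta>" "left_underarc \<Delta> c \<in> diagram_arcs \<Delta>"
        "right_underarc \<Delta> c \<in> diagram_arcs \<Delta>"
        using arcs by (simp_all add: pq overarc_def left_underarc_def right_underarc_def
            arc_before_in_diagram_arcs[OF fin] arc_after_in_diagram_arcs[OF fin])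
      show "overarc ?\<Delta> (id c) = id (overarc \<Delta> c)"
        by (simp add: pq overarc_def arcs_mirror)
      show "left_underarc ?\<Delta> (id c) = id (right_underarc \<Delta> c)"
        "right_underarc ?\<Delta> (id c) = id (left_underarc \<Delta> c)"
        using cross crossing_cross_mirror[OF reg c]
        by (simp_all add: pq left_underarc_def right_underarc_def arcs_mirror)
    qed (simp_all add: pq)
  next
    fix v xs assume v: "v \<in> verts (graph \<Delta>)" and xs: "clockwise_ends \<Delta> v xs"
    then have set: "set xs = vertex_ends (graph \<Delta>) v" by (simp add: clockwise_ends_def)
    show "clockwise_ends ?\<Delta> v (rev xs)" by (rule clockwise_ends_mirror[OF reg v xs])
    fix x assume x: "x \<in> diagram_arcs \<Delta>"
    have ends: "fst y \<in> arcs (graph \<Delta>)" "snd y = 1 \<or> snd y = -1" if "y \<in> set xs" for y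
      using that unfolding set by (auto simp: vertex_ends_def in_arcs_def out_arcs_def)
    show "vertex_coeff ?\<Delta> \<omega> (rev xs) (id x) =
        of_int 1 * t_pow (- \<omega> (fst x)) * invert_t (vertex_coeff \<Delta> \<omega> xs x)"
    proof (rule vertex_coeff_invert_exponents[OF inj_on_id x, where \<pi> = "\<lambda>i. length xs - Suc i"])
      show "arc_of_end \<Delta> y \<in> diagram_arcs \<Delta>" if "y \<in> set xs" for y
        using ends(1)[OF that] by (auto simp: arc_of_end_def split: prod.splits
            intro!: arc_before_in_diagram_arcs[OF fin] arc_after_in_diagram_arcs[OF fin])
      show "bij_betw (\<lambda>i. length xs - Suc i) {..<length xs} {..<length xs}"
        by (rule bij_betw_byWitness[where f' = "\<lambda>i. length xs - Suc i"]) auto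
      fix i assume i: "i < length xs"
      then show "end_exponent \<omega> (rev xs) (length xs - Suc i) =
          - end_exponent \<omega> xs i - \<omega> (fst (xs ! i))"
        using ends(2)[of "xs ! i"] by (intro end_exponent_rev[OF sum_ends_eq_0[OF bal v xs]]) auto
      from i show "arc_of_end ?\<Delta> (rev xs ! (length xs - Suc i)) = id (arc_of_end \<Delta> (xs ! i))"
        "snd (rev xs ! (length xs - Suc i)) = 1 * snd (xs ! i)"
        by (simp_all add: rev_nth arcs_mirror)
    qed simp
  qed (use that in simp_all)
qed

lemma alexander_polynomial_image_graph:
  assumes "plane_reflection \<rho>" and bal: "balanced (graph \<Gamma>) \<omega>"
    and "p \<in> alexander_polynomial \<Gamma> \<omega> k"
  shows "invert_t p \<in> alexander_polynomial (image_graph \<rho> \<Gamma>) \<omega> k"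
proof -
  obtain \<Delta> M where iso: "ambient_isotopic \<Gamma> \<Delta>" and reg: "regular_projection \<Delta>"
    and M: "alexander_matrix \<Delta> \<omega> M" and gcd: "is_minor_gcd M (int (dim_row M) - int k) p"
    using assms(3) by (auto simp: alexander_polynomial_def)
  have "balanced (graph \<Delta>) \<omega>" using iso bal by (simp add: ambient_isotopic_def)
  then obtain M' where "alexander_matrix (image_graph mirror \<Delta>) \<omega> M'"
    and M': "unit_scaled_inversion M M'"
    using alexander_matrix_mirror[OF reg _ M] by blast
  moreover have "dim_row M' = dim_row M" using M' by (simp add: unit_scaled_inversion_def)
  ultimately show ?thesis
    unfolding alexander_polynomial_def mem_Collect_eq
    using ambient_isotopic_image_graph[OF iso assms(1) plane_reflection_mirror]
      regular_projection_mirror[OF reg] is_minor_gcd_unit_scaled_inversion[OF M' gcd]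
    by (intro exI[of _ "image_graph mirror \<Delta>"] exI[of _ M']) simp
qed

section \<open>The Alexander polynomials of the inverse and of the mirror image\<close>

lemma image_graph_involution:
  assumes "plane_reflection \<rho>"
  shows "image_graph \<rho> (image_graph \<rho> \<Gamma>) = \<Gamma>"
proof -
  have "\<rho> (\<rho> x) = x" for x
    using assms reflection_involution by (auto simp: plane_reflection_iff)
  then show ?thesis by (simp add: image_graph_def)
qed

lemma image_invert_t_eqI:
  assumes "\<And>p. p \<in> A \<Longrightarrow> invert_t p \<in> B" and "\<And>p. p \<in> B \<Longrightarrow> invert_t p \<in> A"
  shows "B = invert_t ` A"
  using assms by (metis (no_types, lifting) image_eqI image_subsetI invert_t_invert_t subsetI subset_antisym)

theorem theorem5:
  fixes \<Gamma> :: "('v, 'e) spatial" and \<omega> :: "'e \<Rightarrow> int"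
    and \<rho> :: "real^3 \<Rightarrow> real^3" and k :: nat
  assumes "spatial_graph \<Gamma>" and "balanced (graph \<Gamma>) \<omega>" and "plane_reflection \<rho>"
  shows "alexander_polynomial (inverse_graph \<Gamma>) \<omega> k = alexander_polynomial (image_graph \<rho> \<Gamma>) \<omega> k
    \<and> alexander_polynomial (image_graph \<rho> \<Gamma>) \<omega> k = invert_t ` alexander_polynomial \<Gamma> \<omega> k"
proof -
  have "alexander_polynomial (inverse_graph \<Gamma>) \<omega> k = invert_t ` alexander_polynomial \<Gamma> \<omega> k"
    using alexander_polynomial_inverse_graph[of _ \<Gamma> \<omega> k]
      alexander_polynomial_inverse_graph[of _ "inverse_graph \<Gamma>" \<omega> k]
    by (intro image_invert_t_eqI) simp_all
  moreover have "alexander_polynomial (image_graph \<rho> \<Gamma>) \<omega> k = invert_t ` alexander_polynomial \<Gamma> \<omega> k"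
    using alexander_polynomial_image_graph[OF assms(3), of \<Gamma> \<omega> _ k]
      alexander_polynomial_image_graph[OF assms(3), of "image_graph \<rho> \<Gamma>" \<omega> _ k]
      assms(2) image_graph_involution[OF assms(3), of \<Gamma>]
    by (intro image_invert_t_eqI) simp_all
  ultimately show ?thesis by simp
qed

end
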